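(* There exists a Banach space $Y$ with $T(Y)=C(Y)=2$ that has a closed subspace without the approximation property. (Thus the condition $T(X)=C(X)=2$ on a Banach space $X$ does not imply that every subspace of $X$ has the approximation property.)
   Context: For a Banach space $X$, $T(X)=\sup\{p: X \text{ is of (Rademacher) type } p\}$ and $C(X)=\inf\{q: X\text{ is of (Rademacher) cotype } q\}$. *)

theory Defs
  imports "HOL-Analysis.Analysis" "HOL-Library.Function_Algebras"
begin

text \<open>
  HOL cannot quantify over types inside a formula, so a (real) normed space is a pair \<open>(V, N)\<close>: a linear
  subspace \<open>V\<close> of an ambient real vector space together with a norm \<open>N\<close> on \<open>V\<close>. The ambient space
  carries no topology and the values of \<open>N\<close> outside \<open>V\<close> are irrelevant. With the
  ambient space \<open>nat \<Rightarrow> real\<close> every Banach space of cardinality at most that of the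
  continuum, in particular every separable one, occurs up to isometry as such a pair.
\<close>

instantiation "fun" :: (type, real_vector) real_vector
begin

definition scaleR_fun :: "real \<Rightarrow> ('a \<Rightarrow> 'b) \<Rightarrow> 'a \<Rightarrow> 'b"
  where "scaleR_fun r f = (\<lambda>x. r *\<^sub>R f x)"

instance
  by standard (simp_all add: fun_eq_iff scaleR_fun_def scaleR_add_left scaleR_add_right)

end

lemma scaleR_fun_apply [simp]: "(r *\<^sub>R f) x = r *\<^sub>R f x"
  by (simp add: scaleR_fun_def)

definition normed_space :: "'a::real_vector set \<Rightarrow> ('a \<Rightarrow> real) \<Rightarrow> bool"
  where "normed_space V N \<longleftrightarrow>
    subspace V \<and>
    (\<forall>x\<in>V. 0 \<le> N x) \<and>
    (\<forall>x\<in>V. N x = 0 \<longleftrightarrow> x = 0) \<and>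
    (\<forall>x\<in>V. \<forall>c. N (c *\<^sub>R x) = \<bar>c\<bar> * N x) \<and>
    (\<forall>x\<in>V. \<forall>y\<in>V. N (x + y) \<le> N x + N y)"

text \<open>
  The locale \<open>Metric_space\<close> wants a distance that is nonnegative and symmetric on the whole
  type; hence the value 0 outside \<open>V\<close>.
\<close>

definition norm_dist :: "'a::real_vector set \<Rightarrow> ('a \<Rightarrow> real) \<Rightarrow> 'a \<Rightarrow> 'a \<Rightarrow> real"
  where "norm_dist V N x y = (if x \<in> V \<and> y \<in> V then N (x - y) else 0)"

definition norm_topology :: "'a::real_vector set \<Rightarrow> ('a \<Rightarrow> real) \<Rightarrow> 'a topology"
  where "norm_topology V N = Metric_space.mtopology V (norm_dist V N)"

definition banach_space :: "'a::real_vector set \<Rightarrow> ('a \<Rightarrow> real) \<Rightarrow> bool"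
  where "banach_space V N \<longleftrightarrow>
    normed_space V N \<and> Metric_space.mcomplete V (norm_dist V N)"

lemma Metric_space_norm_dist:
  assumes "normed_space V N"
  shows "Metric_space V (norm_dist V N)"
proof -
  have V: "subspace V"
    and nonneg: "\<And>x. x \<in> V \<Longrightarrow> 0 \<le> N x"
    and zero: "\<And>x. x \<in> V \<Longrightarrow> N x = 0 \<longleftrightarrow> x = 0"
    and scale: "\<And>x c. x \<in> V \<Longrightarrow> N (c *\<^sub>R x) = \<bar>c\<bar> * N x"
    and tri: "\<And>x y. x \<in> V \<Longrightarrow> y \<in> V \<Longrightarrow> N (x + y) \<le> N x + N y"
    using assms by (simp_all add: normed_space_def)
  have diff: "x - y \<in> V" if "x \<in> V" "y \<in> V" for x y
    using V that by (rule subspace_diff)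
  have comm: "N (x - y) = N (y - x)" if "x \<in> V" "y \<in> V" for x y
    using scale[OF diff[OF that(2) that(1)], of "-1"] by simp
  have triangle: "N (x - z) \<le> N (x - y) + N (y - z)" if "x \<in> V" "y \<in> V" "z \<in> V" for x y z
    using tri[OF diff[OF that(1) that(2)] diff[OF that(2) that(3)]] by simp
  show ?thesis
  proof
    show "0 \<le> norm_dist V N x y" for x y
      by (simp add: norm_dist_def nonneg diff)
    show "norm_dist V N x y = norm_dist V N y x" for x y
      using comm[of x y] by (simp add: norm_dist_def)
    show "norm_dist V N x y = 0 \<longleftrightarrow> x = y" if "x \<in> V" "y \<in> V" for x y
      using that zero[OF diff[OF that]] by (simp add: norm_dist_def)
    show "norm_dist V N x z \<le> norm_dist V N x y + norm_dist V N y z"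
      if "x \<in> V" "y \<in> V" "z \<in> V" for x y z
      using that triangle[OF that] by (simp add: norm_dist_def)
  qed
qed

text \<open>
  The expectation of \<open>N(\<epsilon>\<^sub>0 x\<^sub>0 + \<dots> + \<epsilon>\<^sub>n\<^sub>-\<^sub>1 x\<^sub>n\<^sub>-\<^sub>1)\<^sup>p\<close> for independent Rademacher signs
  \<open>\<epsilon>\<^sub>i\<close>, written as the average over all \<open>2\<^sup>n\<close> choices of signs.
\<close>

definition rademacher_average :: "('a::real_vector \<Rightarrow> real) \<Rightarrow> real \<Rightarrow> nat \<Rightarrow> (nat \<Rightarrow> 'a) \<Rightarrow> real"
  where "rademacher_average N p n x =
    (\<Sum>\<epsilon> \<in> {..<n} \<rightarrow>\<^sub>E {- 1, 1}. N (\<Sum>i<n. \<epsilon> i *\<^sub>R x i) powr p) / 2 ^ n"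

text \<open>
  By Kahane's inequality the choice of the moment (here the \<open>p\<close>-th for type and the \<open>q\<close>-th for
  cotype) does not affect these notions.
\<close>

definition rademacher_type :: "'a::real_vector set \<Rightarrow> ('a \<Rightarrow> real) \<Rightarrow> real \<Rightarrow> bool"
  where "rademacher_type V N p \<longleftrightarrow>
    1 \<le> p \<and> p \<le> 2 \<and>
    (\<exists>C>0. \<forall>n. \<forall>x. (\<forall>i<n. x i \<in> V) \<longrightarrow>
      rademacher_average N p n x powr (1 / p) \<le> C * (\<Sum>i<n. N (x i) powr p) powr (1 / p))"

definition rademacher_cotype :: "'a::real_vector set \<Rightarrow> ('a \<Rightarrow> real) \<Rightarrow> real \<Rightarrow> bool"
  where "rademacher_cotype V N q \<longleftrightarrow>
    2 \<le> q \<and>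
    (\<exists>C>0. \<forall>n. \<forall>x. (\<forall>i<n. x i \<in> V) \<longrightarrow>
      (\<Sum>i<n. N (x i) powr q) powr (1 / q) \<le> C * rademacher_average N q n x powr (1 / q))"

text \<open>
  Every normed space has cotype \<open>\<infinity>\<close>. Only finite cotypes enter the infimum below,
  which is \<open>\<infinity>\<close> if there are none.
\<close>

definition type_index :: "'a::real_vector set \<Rightarrow> ('a \<Rightarrow> real) \<Rightarrow> ereal"
  where "type_index V N = Sup {ereal p | p. rademacher_type V N p}"

definition cotype_index :: "'a::real_vector set \<Rightarrow> ('a \<Rightarrow> real) \<Rightarrow> ereal"
  where "cotype_index V N = Inf {ereal q | q. rademacher_cotype V N q}"

definition bounded_operator_on :: "'a::real_vector set \<Rightarrow> ('a \<Rightarrow> real) \<Rightarrow> ('a \<Rightarrow> 'a) \<Rightarrow> bool"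
  where "bounded_operator_on V N T \<longleftrightarrow>
    T ` V \<subseteq> V \<and>
    (\<forall>x\<in>V. \<forall>y\<in>V. T (x + y) = T x + T y) \<and>
    (\<forall>x\<in>V. \<forall>c. T (c *\<^sub>R x) = c *\<^sub>R T x) \<and>
    (\<exists>C. \<forall>x\<in>V. N (T x) \<le> C * N x)"

definition finite_rank_on :: "'a::real_vector set \<Rightarrow> ('a \<Rightarrow> 'a) \<Rightarrow> bool"
  where "finite_rank_on V T \<longleftrightarrow> (\<exists>B. finite B \<and> T ` V \<subseteq> span B)"

definition approximation_property :: "'a::real_vector set \<Rightarrow> ('a \<Rightarrow> real) \<Rightarrow> bool"
  where "approximation_property V N \<longleftrightarrow>
    (\<forall>K. compactin (norm_topology V N) K \<longrightarrow>
      (\<forall>\<epsilon>>0. \<exists>T. bounded_operator_on V N T \<and> finite_rank_on V T \<and>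
        (\<forall>x\<in>K. N (T x - x) < \<epsilon>)))"

end

theory Submission
  imports Defs "HOL-Real_Asymp.Real_Asymp"
begin

text \<open>
  The space \<open>Y\<close> is an \<open>\<ell>\<^sup>2\<close>-sum of finite-dimensional spaces \<open>\<ell>\<^sup>r\<close> with exponents \<open>r < 2\<close> tending to 2.
  Two-point inequalities for the norm, summed over the signs by induction, give cotype 2 and, after
  raising finitely many exponents, type \<open>p\<close> for every \<open>p < 2\<close>.

  The coordinates are the finite words over two letters, and the subspace \<open>Z\<close> is that of Szankowski:
  \<open>2 (x (0w) - x (1w)) = \<Sum>\<^sub>a\<^sub>b x (abw)\<close> for all words \<open>w\<close>. It contains vectors \<open>z w\<close> for which this relation
  expresses the coefficient of \<open>z w\<close> in two ways. For an operator \<open>T\<close> on \<open>Z\<close> let \<open>\<beta> n\<close> be the mean over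
  words of length \<open>n\<close> of the coefficient of \<open>z w\<close> in \<open>T (z w)\<close>. It is 1 for the identity and tends to 0
  for operators of finite rank. The two expressions make \<open>\<beta> (n + 1) - \<beta> n\<close> a mean of diagonal terms
  \<open>(T (y u)) u\<close>, where \<open>y u\<close> has few coordinates and none at \<open>u\<close>. Grouping the words \<open>u\<close> into the blocks
  of \<open>Y\<close> and choosing signs, the sum over a block of size \<open>k\<close> is at most \<open>k powr (1 - 1 / r)\<close> times the
  norm of \<open>T (\<Sum> \<plusminus> y u)\<close>. The coordinates of the vectors \<open>y u\<close> lie in different blocks, so
  \<open>\<Sum> \<plusminus> y u\<close> has norm of order \<open>sqrt k\<close> only. The gain \<open>k powr (1 / 2 - 1 / r)\<close> allows these vectors to be
  rescaled to a compact set on which the identity cannot be approximated.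
\<close>

section \<open>Inequalities for finite sequences\<close>

text \<open>Convexity on the open half-line comes from the second derivative. If one point is 0, the
  claim reduces to \<open>s powr q \<le> s\<close> for \<open>s\<close> in the unit
  interval.\<close>

lemma powr_convex_combination:
  fixes x y t q :: real
  assumes "q \<ge> 1" "x \<ge> 0" "y \<ge> 0" "0 \<le> t" "t \<le> 1"
  shows "((1 - t) * x + t * y) powr q \<le> (1 - t) * x powr q + t * y powr q"
proof -
  have shrink: "(s * z) powr q \<le> s * z powr q" if "0 \<le> s" "s \<le> 1" "0 \<le> z" for s z :: real
  proof -
    have "s powr q \<le> s"
      using powr_mono'[of 1 q s] that assms(1) by simp
    then show ?thesis
      using that by (simp add: powr_mult mult_right_mono)
  qed
  have conv: "convex_on {0<..} (\<lambda>x::real. x powr q)"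
  proof (rule f''_ge0_imp_convex)
    show "((\<lambda>x. x powr q) has_real_derivative q * x powr (q - 1)) (at x)" if "x \<in> {0<..}" for x :: real
      using that by (auto intro!: derivative_eq_intros)
    show "((\<lambda>x. q * x powr (q - 1)) has_real_derivative q * ((q - 1) * x powr (q - 1 - 1))) (at x)"
      if "x \<in> {0<..}" for x :: real
      using that by (auto intro!: derivative_eq_intros)
  qed (use assms(1) in auto)
  consider "x = 0" | "y = 0" | "x > 0" "y > 0" using assms by linarith
  then show ?thesis
  proof cases
    case 1 then show ?thesis using shrink[of t y] assms by simp
  next
    case 2 then show ?thesis using shrink[of "1 - t" x] assms by simp
  next
    case 3
    then show ?thesis using convex_onD[OF conv, of t x y] assms by simp
  qed
qed

definition lp_norm :: "real \<Rightarrow> 'a set \<Rightarrow> ('a \<Rightarrow> real) \<Rightarrow> real"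
  where "lp_norm q A a = (\<Sum>i\<in>A. \<bar>a i\<bar> powr q) powr (1 / q)"

lemma lp_norm_nonneg [simp]: "0 \<le> lp_norm q A a"
  by (simp add: lp_norm_def)

lemma lp_norm_powr: "q > 0 \<Longrightarrow> lp_norm q A a powr q = (\<Sum>i\<in>A. \<bar>a i\<bar> powr q)"
  by (simp add: lp_norm_def powr_powr sum_nonneg)

lemma lp_norm_le_iff:
  assumes "q > 0" "c \<ge> 0"
  shows "lp_norm q A a \<le> c \<longleftrightarrow> (\<Sum>i\<in>A. \<bar>a i\<bar> powr q) \<le> c powr q"
proof -
  have "lp_norm q A a \<le> c \<longleftrightarrow> lp_norm q A a powr q \<le> c powr q"
    using assms powr_mono2[of q "lp_norm q A a" c] powr_less_mono2[of q c "lp_norm q A a"]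
    by (meson lp_norm_nonneg less_imp_le not_le)
  then show ?thesis using assms by (simp add: lp_norm_powr)
qed

lemma lp_norm_mono:
  assumes "q > 0" "\<And>i. i \<in> A \<Longrightarrow> \<bar>a i\<bar> \<le> \<bar>b i\<bar>"
  shows "lp_norm q A a \<le> lp_norm q A b"
  unfolding lp_norm_def using assms
  by (intro powr_mono2 sum_mono sum_nonneg) auto

lemma lp_norm_scale:
  assumes "q > 0"
  shows "lp_norm q A (\<lambda>i. c * a i) = \<bar>c\<bar> * lp_norm q A a"
  using assms
  by (simp add: lp_norm_def abs_mult powr_mult sum_nonneg powr_powr flip: sum_distrib_left)

lemma abs_le_lp_norm:
  assumes "q > 0" "finite A" "i \<in> A"
  shows "\<bar>a i\<bar> \<le> lp_norm q A a"
proof -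
  have "\<bar>a i\<bar> powr q \<le> (\<Sum>i\<in>A. \<bar>a i\<bar> powr q)"
    using assms by (intro member_le_sum) auto
  then have "(\<bar>a i\<bar> powr q) powr (1 / q) \<le> lp_norm q A a"
    unfolding lp_norm_def using assms by (intro powr_mono2) auto
  then show ?thesis using assms by (simp add: powr_powr)
qed

lemma lp_norm_eq_0_iff:
  assumes "q > 0" "finite A"
  shows "lp_norm q A a = 0 \<longleftrightarrow> (\<forall>i\<in>A. a i = 0)"
  using assms by (auto simp: lp_norm_def sum_nonneg_eq_0_iff)

text \<open>After division by the sum of the two norms, \<open>a + b\<close> becomes a convex
  combination of the normalised sequences, with weights proportional to the norms. Convexity of the
  power is applied in each coordinate and summed.\<close>

lemma Minkowski_inequality:
  assumes q: "q \<ge> 1" and A: "finite A"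
  shows "lp_norm q A (\<lambda>i. a i + b i) \<le> lp_norm q A a + lp_norm q A b"
proof -
  let ?a = "lp_norm q A a" and ?b = "lp_norm q A b"
  have q0: "q > 0" using q by simp
  consider "?a = 0" | "?b = 0" | "?a > 0" "?b > 0"
    using lp_norm_nonneg[of q A a] lp_norm_nonneg[of q A b] by linarith
  then show ?thesis
  proof cases
    case 1
    then show ?thesis
      using lp_norm_eq_0_iff[OF q0 A, of a] lp_norm_mono[OF q0, of A "\<lambda>i. a i + b i" b] by simp
  next
    case 2
    then show ?thesis
      using lp_norm_eq_0_iff[OF q0 A, of b] lp_norm_mono[OF q0, of A "\<lambda>i. a i + b i" a] by simp
  next
    case 3
    define s where "s = ?a + ?b"
    define t where "t = ?b / s"
    have s: "s > 0" using 3 by (simp add: s_def)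
    have t: "0 \<le> t" "t \<le> 1" "1 - t = ?a / s"
      using 3 by (auto simp: t_def s_def field_simps)
    have "\<bar>a i + b i\<bar> powr q \<le> s powr q * ((1 - t) * (\<bar>a i\<bar> powr q / ?a powr q) + t * (\<bar>b i\<bar> powr q / ?b powr q))" for i
    proof -
      have eq: "\<bar>a i\<bar> + \<bar>b i\<bar> = s * ((1 - t) * (\<bar>a i\<bar> / ?a) + t * (\<bar>b i\<bar> / ?b))"
        using 3 s unfolding t(3) by (simp add: t_def distrib_left)
      have "\<bar>a i + b i\<bar> powr q \<le> (\<bar>a i\<bar> + \<bar>b i\<bar>) powr q"
        using q by (intro powr_mono2) auto
      also have "\<dots> = s powr q * ((1 - t) * (\<bar>a i\<bar> / ?a) + t * (\<bar>b i\<bar> / ?b)) powr q"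
        unfolding eq using s t(1,2) 3 by (subst powr_mult) auto
      also have "\<dots> \<le> s powr q * ((1 - t) * (\<bar>a i\<bar> / ?a) powr q + t * (\<bar>b i\<bar> / ?b) powr q)"
        using q t 3 by (intro mult_left_mono powr_convex_combination) auto
      finally show ?thesis using 3 by (simp add: powr_divide)
    qed
    then have "(\<Sum>i\<in>A. \<bar>a i + b i\<bar> powr q)
        \<le> (\<Sum>i\<in>A. s powr q * ((1 - t) * (\<bar>a i\<bar> powr q / ?a powr q) + t * (\<bar>b i\<bar> powr q / ?b powr q)))"
      by (intro sum_mono)
    also have "\<dots> = s powr q * ((1 - t) * ((\<Sum>i\<in>A. \<bar>a i\<bar> powr q) / ?a powr q) + t * ((\<Sum>i\<in>A. \<bar>b i\<bar> powr q) / ?b powr q))"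
      by (simp add: sum.distrib sum_distrib_left sum_divide_distrib distrib_left)
    also have "\<dots> = s powr q * ((1 - t) * (?a powr q / ?a powr q) + t * (?b powr q / ?b powr q))"
      by (simp only: lp_norm_powr[OF q0])
    also have "\<dots> = s powr q" using 3 by simp
    finally show ?thesis
      using s by (subst lp_norm_le_iff) (auto simp: s_def q0)
  qed
qed

lemma lp_norm_sum_le:
  assumes "q \<ge> 1" "finite A"
  shows "lp_norm q A (\<lambda>i. \<Sum>k\<in>K. f k i) \<le> (\<Sum>k\<in>K. lp_norm q A (f k))"
proof (induction K rule: infinite_finite_induct)
  case (insert k K)
  then show ?case
    using Minkowski_inequality[OF assms, of "f k" "\<lambda>i. \<Sum>k\<in>K. f k i"] by simp
qed (use assms in \<open>simp_all add: lp_norm_def\<close>)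

text \<open>This is the triangle inequality in the two-dimensional l^q for the vectors
  \<open>(u k, v k)\<close>. With \<open>q = 2 / r\<close> it interchanges an l^r sum over
  coordinates with an l^2 sum over two vectors.\<close>

lemma sum_powr_pair_le:
  fixes u v :: "'a \<Rightarrow> real"
  assumes q: "q \<ge> 1" and "\<And>k. k \<in> K \<Longrightarrow> u k \<ge> 0" "\<And>k. k \<in> K \<Longrightarrow> v k \<ge> 0"
  shows "(sum u K) powr q + (sum v K) powr q \<le> (\<Sum>k\<in>K. (u k powr q + v k powr q) powr (1 / q)) powr q"
proof -
  have *: "lp_norm q UNIV (\<lambda>b. if b then x else y) = (x powr q + y powr q) powr (1 / q)"
    if "x \<ge> 0" "y \<ge> 0" for x y :: real
    using that by (simp add: lp_norm_def UNIV_bool add.commute)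
  have "lp_norm q UNIV (\<lambda>b. \<Sum>k\<in>K. if b then u k else v k)
      \<le> (\<Sum>k\<in>K. lp_norm q UNIV (\<lambda>b. if b then u k else v k))"
    using q by (intro lp_norm_sum_le) auto
  also have "\<dots> = (\<Sum>k\<in>K. (u k powr q + v k powr q) powr (1 / q))"
    using assms by (intro sum.cong *) auto
  also have "(\<lambda>b. \<Sum>k\<in>K. if b then u k else v k) = (\<lambda>b. if b then sum u K else sum v K)"
    by auto
  finally have "(sum u K powr q + sum v K powr q) powr (1 / q) \<le> (\<Sum>k\<in>K. (u k powr q + v k powr q) powr (1 / q))"
    using *[of "sum u K" "sum v K"] assms by (simp add: sum_nonneg)
  then have "((sum u K powr q + sum v K powr q) powr (1 / q)) powr q
     \<le> (\<Sum>k\<in>K. (u k powr q + v k powr q) powr (1 / q)) powr q"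
    using q by (intro powr_mono2) auto
  then show ?thesis using q by (simp add: powr_powr)
qed

lemma Minkowski_suminf:
  fixes a b :: "nat \<Rightarrow> real"
  assumes q: "q \<ge> 1" and pos: "\<And>n. a n \<ge> 0" "\<And>n. b n \<ge> 0"
    and sm: "summable (\<lambda>n. a n powr q)" "summable (\<lambda>n. b n powr q)"
  shows "summable (\<lambda>n. (a n + b n) powr q)"
    and "(\<Sum>n. (a n + b n) powr q) powr (1 / q)
      \<le> (\<Sum>n. a n powr q) powr (1 / q) + (\<Sum>n. b n powr q) powr (1 / q)" (is "_ \<le> ?R")
proof -
  have part: "(\<Sum>n<m. (a n + b n) powr q) \<le> ?R powr q" for m
  proof -
    have "lp_norm q {..<m} (\<lambda>n. a n + b n) \<le> lp_norm q {..<m} a + lp_norm q {..<m} b"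
      using q by (intro Minkowski_inequality) auto
    also have "\<dots> \<le> ?R"
      unfolding lp_norm_def using q pos
      by (intro add_mono powr_mono2)
        (auto intro!: sum_nonneg sum_le_suminf sm)
    finally show ?thesis
      using q pos by (subst (asm) lp_norm_le_iff) auto
  qed
  show s: "summable (\<lambda>n. (a n + b n) powr q)"
    by (rule bounded_imp_summable[where B = "?R powr q"])
      (use part[of "Suc _"] in \<open>auto simp: lessThan_Suc_atMost\<close>)
  have "(\<Sum>n. (a n + b n) powr q) \<le> ?R powr q"
    by (intro suminf_le_const s part)
  then have "(\<Sum>n. (a n + b n) powr q) powr (1 / q) \<le> (?R powr q) powr (1 / q)"
    using q by (intro powr_mono2 suminf_nonneg s) auto
  then show "(\<Sum>n. (a n + b n) powr q) powr (1 / q) \<le> ?R"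
    using q by (simp add: powr_powr)
qed

text \<open>Jensen's inequality with equal weights on \<open>A\<close>. Its factor is the price of
  passing from a diagonal sum over a block to the norm of that block.\<close>

lemma sum_abs_le_lp_norm:
  assumes q: "q \<ge> 1" and A: "finite A"
  shows "(\<Sum>i\<in>A. \<bar>a i\<bar>) \<le> real (card A) powr (1 - 1 / q) * lp_norm q A a"
proof (cases "A = {}")
  case False
  define n where "n = real (card A)"
  have n: "n > 0" using False A by (simp add: n_def card_gt_0_iff)
  have conv: "convex_on {0..} (\<lambda>x::real. x powr q)"
    unfolding convex_on_alt
  proof (intro conjI ballI allI impI)
    fix x y \<mu> :: real
    assume "x \<in> {0..}" "y \<in> {0..}" "0 \<le> \<mu> \<and> \<mu> \<le> 1"
    then show "(\<mu> *\<^sub>R x + (1 - \<mu>) *\<^sub>R y) powr q \<le> \<mu> * x powr q + (1 - \<mu>) * y powr q"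
      using powr_convex_combination[OF q, of x y "1 - \<mu>"] by simp
  qed simp
  have "(\<Sum>i\<in>A. (1 / n) *\<^sub>R \<bar>a i\<bar>) powr q \<le> (\<Sum>i\<in>A. (1 / n) * \<bar>a i\<bar> powr q)"
    by (rule convex_on_sum[OF A False conv]) (use n in \<open>auto simp: n_def\<close>)
  then have "((\<Sum>i\<in>A. \<bar>a i\<bar>) / n) powr q \<le> (\<Sum>i\<in>A. \<bar>a i\<bar> powr q) / n"
    by (simp add: sum_divide_distrib)
  then have "(((\<Sum>i\<in>A. \<bar>a i\<bar>) / n) powr q) powr (1 / q) \<le> ((\<Sum>i\<in>A. \<bar>a i\<bar> powr q) / n) powr (1 / q)"
    using q by (intro powr_mono2) auto
  then have "(\<Sum>i\<in>A. \<bar>a i\<bar>) / n \<le> lp_norm q A a / n powr (1 / q)"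
    using q n by (simp add: powr_powr powr_divide sum_nonneg lp_norm_def)
  then show ?thesis
    using n by (simp add: n_def[symmetric] powr_diff field_simps)
qed (simp add: lp_norm_def)

section \<open>Two-point inequalities in finite-dimensional l^r\<close>

text \<open>The right side minus the quadratic term is \<open>f\<close>, with
  \<open>f 0 = 1\<close>, vanishing first derivative at 0 and nonnegative second derivative.\<close>

lemma convexity_expansion_le:
  fixes r t :: real
  assumes r: "1 < r" "r \<le> 2" and t: "0 \<le> t" "t \<le> 1"
  shows "1 + r * (r - 1) / 2 * t\<^sup>2 \<le> ((1 + t) powr r + (1 - t) powr r) / 2"
proof -
  define f where "f = (\<lambda>t::real. ((1 + t) powr r + (1 - t) powr r) / 2 - r * (r - 1) / 2 * t\<^sup>2)"
  define g where "g = (\<lambda>t::real. (r * (1 + t) powr (r - 1) - r * (1 - t) powr (r - 1)) / 2 - r * (r - 1) * t)"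
  define k where "k = (\<lambda>t::real. r * (r - 1) * (((1 + t) powr (r - 2) + (1 - t) powr (r - 2)) / 2 - 1))"
  have f': "(f has_real_derivative g t) (at t)" if "0 \<le> t" "t < 1" for t
    unfolding f_def g_def using that by (auto intro!: derivative_eq_intros simp: field_simps)
  have g': "(g has_real_derivative k t) (at t)" if "0 \<le> t" "t < 1" for t
    unfolding g_def k_def using that
    by (auto intro!: derivative_eq_intros simp: field_simps)
  have k: "0 \<le> k t" if "0 \<le> t" "t < 1" for t
  proof -
    define A where "A = (1 + t) powr (r - 2)"
    define B where "B = (1 - t) powr (r - 2)"
    have "A * B = (1 - t * t) powr (r - 2)"
      using that unfolding A_def B_def by (subst powr_mult [symmetric]) (auto simp: algebra_simps)
    moreover have tt: "t * t < 1" using that mult_left_le[of t t] by linarith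
    moreover have "(1 - t * t) powr 0 \<le> (1 - t * t) powr (r - 2)"
      using r tt by (intro powr_mono') auto
    \<comment> \<open>The two powers have product at least 1, so by the arithmetic-geometric mean
      inequality their sum is at least 2.\<close>
    ultimately have "A * B \<ge> 1" using that by simp
    then have "(A + B)\<^sup>2 \<ge> 2\<^sup>2"
      using sum_squares_bound[of A B] by (simp add: power2_sum)
    then have "A + B \<ge> 2"
      by (rule power2_le_imp_le) (simp add: A_def B_def)
    then show ?thesis using r by (simp add: k_def A_def B_def)
  qed
  have g0: "0 \<le> g t" if "0 \<le> t" "t < 1" for t
  proof -
    have "g 0 \<le> g t"
    proof (rule DERIV_nonneg_imp_nondecreasing[of 0 t g])
      show "\<exists>y. (g has_real_derivative y) (at x) \<and> 0 \<le> y" if "0 \<le> x" "x \<le> t" for x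
        using g'[of x] k[of x] that \<open>t < 1\<close> by auto
    qed (use that in auto)
    then show ?thesis by (simp add: g_def)
  qed
  have "f 0 \<le> f t"
  proof (cases "t = 0")
    case False
    \<comment> \<open>The derivative formula is established only below 1. The mean value theorem
      needs mere continuity at the endpoint and so covers \<open>t = 1\<close>.\<close>
    have "\<exists>l z. 0 < z \<and> z < t \<and> (f has_real_derivative l) (at z) \<and> f t - f 0 = (t - 0) * l"
    proof (rule MVT)
      show "continuous_on {0..t} f"
        unfolding f_def using t r by (intro continuous_intros continuous_on_powr') auto
      show "f differentiable at x" if "0 < x" "x < t" for x
        using f'[of x] that t real_differentiable_def by auto
    qed (use t False in auto)
    then obtain l z where z: "0 < z" "z < t" "(f has_real_derivative l) (at z)" "f t - f 0 = (t - 0) * l"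
      by blast
    then have "l = g z" using f'[of z] t DERIV_unique by force
    then have "l \<ge> 0" using g0[of z] z t by simp
    then have "0 \<le> t * l" using t by simp
    then show ?thesis using z(4) by auto
  qed simp
  then show ?thesis by (simp add: f_def diff_divide_distrib add_divide_distrib)
qed

lemma abs_powr_2: "\<bar>x::real\<bar> powr 2 = x\<^sup>2"
  by (simp add: powr_numeral)

lemma power2_powr_half: "(x\<^sup>2) powr (p / 2) = \<bar>x::real\<bar> powr p"
proof -
  have "(x\<^sup>2) powr (p / 2) = (\<bar>x\<bar> powr 2) powr (p / 2)" by (simp only: abs_powr_2)
  then show ?thesis by (simp only: powr_powr) simp
qed

text \<open>For \<open>\<bar>b\<bar> \<le> \<bar>a\<bar>\<close> homogeneity reduces the claim to
  \<open>t = \<bar>b\<bar> / \<bar>a\<bar>\<close> and the quadratic expansion. Otherwise exchanging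
  \<open>a\<close> and \<open>b\<close> only enlarges the left side, because
  \<open>r - 1 \<le> 1\<close>.\<close>

lemma two_point_convexity:
  fixes a b r :: real
  assumes r: "1 < r" "r \<le> 2"
  shows "(a\<^sup>2 + (r - 1) * b\<^sup>2) powr (r / 2) \<le> (\<bar>a + b\<bar> powr r + \<bar>a - b\<bar> powr r) / 2"
proof -
  have main: "(a\<^sup>2 + (r - 1) * b\<^sup>2) powr (r / 2) \<le> (\<bar>a + b\<bar> powr r + \<bar>a - b\<bar> powr r) / 2"
    if ab: "\<bar>b\<bar> \<le> \<bar>a\<bar>" and a: "a \<noteq> 0" for a b :: real
  proof -
    define t where "t = \<bar>b\<bar> / \<bar>a\<bar>"
    have t: "0 \<le> t" "t \<le> 1" "\<bar>b\<bar> = \<bar>a\<bar> * t" using ab a by (auto simp: t_def)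
    have "b\<^sup>2 = \<bar>b\<bar>\<^sup>2" by simp
    then have b2: "b\<^sup>2 = a\<^sup>2 * t\<^sup>2" unfolding t(3) by (simp add: power_mult_distrib)
    have "{\<bar>a + b\<bar>, \<bar>a - b\<bar>} = {\<bar>a\<bar> + \<bar>b\<bar>, \<bar>a\<bar> - \<bar>b\<bar>}" using ab by auto
    then have "\<bar>a + b\<bar> powr r + \<bar>a - b\<bar> powr r = (\<bar>a\<bar> + \<bar>b\<bar>) powr r + (\<bar>a\<bar> - \<bar>b\<bar>) powr r"
      by (auto simp: doubleton_eq_iff)
    also have "\<dots> = (\<bar>a\<bar> * (1 + t)) powr r + (\<bar>a\<bar> * (1 - t)) powr r"
      unfolding t(3) by (simp add: algebra_simps)
    also have "\<dots> = \<bar>a\<bar> powr r * ((1 + t) powr r + (1 - t) powr r)"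
      using t(1,2) by (subst (1 2) powr_mult) (auto simp: distrib_left)
    finally have R: "\<bar>a + b\<bar> powr r + \<bar>a - b\<bar> powr r = \<bar>a\<bar> powr r * ((1 + t) powr r + (1 - t) powr r)" .
    have "(a\<^sup>2 + (r - 1) * b\<^sup>2) powr (r / 2) = (a\<^sup>2 * (1 + (r - 1) * t\<^sup>2)) powr (r / 2)"
      unfolding b2 by (simp add: algebra_simps)
    also have "\<dots> = \<bar>a\<bar> powr r * (1 + (r - 1) * t\<^sup>2) powr (r / 2)"
      using r by (subst powr_mult) (auto simp: power2_powr_half)
    also have "\<dots> \<le> \<bar>a\<bar> powr r * (1 + r * (r - 1) / 2 * t\<^sup>2)"
    proof (rule mult_left_mono)
      have pos: "1 + (r - 1) * t\<^sup>2 > 0" using r by (smt (verit) mult_nonneg_nonneg zero_le_power2)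
      \<comment> \<open>Young's inequality against 1 bounds the concave power \<open>r / 2\<close>
        by its tangent at 1.\<close>
      have "(1 + (r - 1) * t\<^sup>2) powr (r / 2) * 1 powr (1 - r / 2)
          \<le> r / 2 * (1 + (r - 1) * t\<^sup>2) + (1 - r / 2) * 1"
        using r pos by (intro Youngs_inequality_0) auto
      then show "(1 + (r - 1) * t\<^sup>2) powr (r / 2) \<le> 1 + r * (r - 1) / 2 * t\<^sup>2"
        by (simp add: algebra_simps diff_divide_distrib)
    qed simp
    also have "\<dots> \<le> \<bar>a\<bar> powr r * (((1 + t) powr r + (1 - t) powr r) / 2)"
      using convexity_expansion_le[OF r t(1,2)] by (intro mult_left_mono) auto
    finally show ?thesis unfolding R by simp
  qed
  consider "a = 0" "b = 0" | "\<bar>b\<bar> \<le> \<bar>a\<bar>" "a \<noteq> 0" | "\<bar>a\<bar> < \<bar>b\<bar>" by fastforce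
  then show ?thesis
  proof cases
    case 3
    have "a\<^sup>2 \<le> b\<^sup>2" using 3 by (simp add: abs_le_square_iff flip: abs_le_square_iff)
    then have "(2 - r) * a\<^sup>2 \<le> (2 - r) * b\<^sup>2" using r by (intro mult_left_mono) auto
    then have "a\<^sup>2 + (r - 1) * b\<^sup>2 \<le> b\<^sup>2 + (r - 1) * a\<^sup>2" by (simp add: algebra_simps)
    then have "(a\<^sup>2 + (r - 1) * b\<^sup>2) powr (r / 2) \<le> (b\<^sup>2 + (r - 1) * a\<^sup>2) powr (r / 2)"
      using r by (intro powr_mono2) auto
    also have "\<dots> \<le> (\<bar>b + a\<bar> powr r + \<bar>b - a\<bar> powr r) / 2"
      using 3 by (intro main) auto
    finally show ?thesis by (simp add: add.commute abs_minus_commute)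
  qed (use main in auto)
qed

text \<open>The inequality for pairs moves the outer power \<open>2 / r\<close> inside the sum, the
  scalar inequality acts on each coordinate, and convexity of that power separates the two resulting
  sums.\<close>

lemma lp_norm_two_point_convex:
  assumes r: "1 < r" "r \<le> 2"
  shows "lp_norm r A x powr 2 + (r - 1) * lp_norm r A y powr 2
    \<le> (lp_norm r A (\<lambda>i. x i + y i) powr 2 + lp_norm r A (\<lambda>i. x i - y i) powr 2) / 2"
proof -
  define q where "q = 2 / r"
  have q: "q \<ge> 1" "r * q = 2" "1 / q = r / 2" using r by (auto simp: q_def)
  have lp2: "lp_norm r A z powr 2 = (\<Sum>i\<in>A. \<bar>z i\<bar> powr r) powr q" for z
    using r by (simp add: lp_norm_def powr_powr q_def)
  have "(r - 1) * lp_norm r A y powr 2 = (\<Sum>i\<in>A. (r - 1) powr (r / 2) * \<bar>y i\<bar> powr r) powr q"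
    using r by (simp add: lp2 powr_mult powr_powr sum_nonneg q_def flip: sum_distrib_left)
  then have "lp_norm r A x powr 2 + (r - 1) * lp_norm r A y powr 2
      = (\<Sum>i\<in>A. \<bar>x i\<bar> powr r) powr q + (\<Sum>i\<in>A. (r - 1) powr (r / 2) * \<bar>y i\<bar> powr r) powr q"
    by (simp add: lp2)
  also have "\<dots> \<le> (\<Sum>i\<in>A. ((\<bar>x i\<bar> powr r) powr q + ((r - 1) powr (r / 2) * \<bar>y i\<bar> powr r) powr q) powr (1 / q)) powr q"
    by (intro sum_powr_pair_le q) auto
  also have "(\<Sum>i\<in>A. ((\<bar>x i\<bar> powr r) powr q + ((r - 1) powr (r / 2) * \<bar>y i\<bar> powr r) powr q) powr (1 / q))
    = (\<Sum>i\<in>A. ((x i)\<^sup>2 + (r - 1) * (y i)\<^sup>2) powr (r / 2))"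
    using r q unfolding q(3) by (simp add: powr_powr powr_mult abs_powr_2 q_def)
  also have "\<dots> powr q \<le> (\<Sum>i\<in>A. (\<bar>x i + y i\<bar> powr r + \<bar>x i - y i\<bar> powr r) / 2) powr q"
    using q by (intro powr_mono2 sum_mono two_point_convexity r sum_nonneg) auto
  also have "(\<Sum>i\<in>A. (\<bar>x i + y i\<bar> powr r + \<bar>x i - y i\<bar> powr r) / 2)
     = (1 - 1 / 2) * (\<Sum>i\<in>A. \<bar>x i + y i\<bar> powr r) + 1 / 2 * (\<Sum>i\<in>A. \<bar>x i - y i\<bar> powr r)"
    by (simp add: sum.distrib flip: sum_divide_distrib)
  also have "\<dots> powr q \<le> (1 - 1 / 2) * (\<Sum>i\<in>A. \<bar>x i + y i\<bar> powr r) powr q + 1 / 2 * (\<Sum>i\<in>A. \<bar>x i - y i\<bar> powr r) powr q"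
    by (intro powr_convex_combination q sum_nonneg) auto
  finally show ?thesis by (simp add: lp2)
qed

text \<open>The inequality for pairs again moves the power \<open>2 / s\<close> inside. In each
  coordinate the parallelogram identity then computes the sum of squares exactly.\<close>

lemma lp_norm_two_point_smooth:
  assumes s: "1 \<le> s" "s \<le> 2"
  shows "(lp_norm s A (\<lambda>i. x i + y i) powr 2 + lp_norm s A (\<lambda>i. x i - y i) powr 2) / 2
    \<le> lp_norm s A (\<lambda>i. sqrt ((x i)\<^sup>2 + (y i)\<^sup>2)) powr 2"
proof -
  define q where "q = 2 / s"
  have q: "q \<ge> 1" "s * q = 2" "1 / q = s / 2" using s by (auto simp: q_def)
  have lp2: "lp_norm s A z powr 2 = (\<Sum>i\<in>A. \<bar>z i\<bar> powr s) powr q" for z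
    using s by (simp add: lp_norm_def powr_powr q_def)
  have "(\<Sum>i\<in>A. \<bar>x i + y i\<bar> powr s) powr q + (\<Sum>i\<in>A. \<bar>x i - y i\<bar> powr s) powr q
      \<le> (\<Sum>i\<in>A. ((\<bar>x i + y i\<bar> powr s) powr q + (\<bar>x i - y i\<bar> powr s) powr q) powr (1 / q)) powr q"
    by (intro sum_powr_pair_le q) auto
  also have "(\<Sum>i\<in>A. ((\<bar>x i + y i\<bar> powr s) powr q + (\<bar>x i - y i\<bar> powr s) powr q) powr (1 / q))
     = (\<Sum>i\<in>A. 2 powr (1 / q) * \<bar>sqrt ((x i)\<^sup>2 + (y i)\<^sup>2)\<bar> powr s)"
  proof (rule sum.cong[OF refl])
    fix i
    have "(\<bar>x i + y i\<bar> powr s) powr q + (\<bar>x i - y i\<bar> powr s) powr q = 2 * ((x i)\<^sup>2 + (y i)\<^sup>2)"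
      using q by (simp add: powr_powr abs_powr_2 power2_sum power2_diff)
    also have "\<dots> powr (1 / q) = 2 powr (1 / q) * ((x i)\<^sup>2 + (y i)\<^sup>2) powr (s / 2)"
      by (subst powr_mult) (simp_all add: q)
    also have "((x i)\<^sup>2 + (y i)\<^sup>2) powr (s / 2) = \<bar>sqrt ((x i)\<^sup>2 + (y i)\<^sup>2)\<bar> powr s"
      by (simp add: powr_half_sqrt [symmetric] powr_powr)
    finally show "((\<bar>x i + y i\<bar> powr s) powr q + (\<bar>x i - y i\<bar> powr s) powr q) powr (1 / q)
      = 2 powr (1 / q) * \<bar>sqrt ((x i)\<^sup>2 + (y i)\<^sup>2)\<bar> powr s" .
  qed
  also have "\<dots> powr q = 2 * (\<Sum>i\<in>A. \<bar>sqrt ((x i)\<^sup>2 + (y i)\<^sup>2)\<bar> powr s) powr q"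
    using q by (simp add: powr_mult sum_nonneg powr_powr flip: sum_distrib_left)
  finally show ?thesis unfolding lp2 by simp
qed

lemma powr_add_le_add_powr:
  fixes a b s :: real
  assumes "0 \<le> a" "0 \<le> b" "0 < s" "s \<le> 1"
  shows "(a + b) powr s \<le> a powr s + b powr s"
proof (cases "a + b = 0")
  case False
  then have ab: "a + b > 0" using assms by simp
  have *: "z / (a + b) * (a + b) powr s \<le> z powr s" if "0 \<le> z" "z \<le> a + b" for z
  proof -
    have "(z / (a + b)) powr 1 \<le> (z / (a + b)) powr s"
      using assms that ab by (intro powr_mono') auto
    then have "z / (a + b) \<le> z powr s / (a + b) powr s"
      using that ab by (simp add: powr_divide)
    then show ?thesis using ab by (simp add: field_simps)
  qed
  have "(a + b) powr s = a / (a + b) * (a + b) powr s + b / (a + b) * (a + b) powr s"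
    using ab by (simp flip: distrib_right add_divide_distrib)
  then show ?thesis using *[of a] *[of b] assms by linarith
qed (use assms in auto)

text \<open>Since \<open>p / 2 \<le> 1\<close>, the \<open>p\<close>-th power of the square root is
  at most \<open>\<bar>x i\<bar> powr p + \<bar>y i\<bar> powr p\<close>. What remains is the
  triangle inequality in l^(s/p).\<close>

lemma lp_norm_two_point_concavity:
  assumes p: "1 \<le> p" "p \<le> s" and s: "s \<le> 2" and A: "finite A"
  shows "lp_norm s A (\<lambda>i. sqrt ((x i)\<^sup>2 + (y i)\<^sup>2)) powr p \<le> lp_norm s A x powr p + lp_norm s A y powr p"
proof -
  have q: "s / p \<ge> 1" using p by simp
  have conv: "lp_norm s A z powr p = lp_norm (s / p) A (\<lambda>i. \<bar>z i\<bar> powr p)" for z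
    using p by (simp add: lp_norm_def powr_powr)
  have "lp_norm s A (\<lambda>i. sqrt ((x i)\<^sup>2 + (y i)\<^sup>2)) powr p
     = lp_norm (s / p) A (\<lambda>i. \<bar>sqrt ((x i)\<^sup>2 + (y i)\<^sup>2)\<bar> powr p)"
    by (rule conv)
  also have "\<dots> \<le> lp_norm (s / p) A (\<lambda>i. \<bar>x i\<bar> powr p + \<bar>y i\<bar> powr p)"
  proof (rule lp_norm_mono)
    fix i
    have "\<bar>sqrt ((x i)\<^sup>2 + (y i)\<^sup>2)\<bar> powr p = ((x i)\<^sup>2 + (y i)\<^sup>2) powr (p / 2)"
      by (simp add: powr_half_sqrt [symmetric] powr_powr)
    also have "\<dots> \<le> ((x i)\<^sup>2) powr (p / 2) + ((y i)\<^sup>2) powr (p / 2)"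
      using p s by (intro powr_add_le_add_powr) auto
    also have "\<dots> = \<bar>x i\<bar> powr p + \<bar>y i\<bar> powr p"
      by (simp only: power2_powr_half)
    finally show "\<bar>\<bar>sqrt ((x i)\<^sup>2 + (y i)\<^sup>2)\<bar> powr p\<bar> \<le> \<bar>\<bar>x i\<bar> powr p + \<bar>y i\<bar> powr p\<bar>" by simp
  qed (use q in simp)
  also have "\<dots> \<le> lp_norm s A x powr p + lp_norm s A y powr p"
    unfolding conv[of x] conv[of y] by (rule Minkowski_inequality[OF q A])
  finally show ?thesis .
qed

section \<open>Rademacher averages and two-point inequalities\<close>

lemma sum_signs_Suc:
  fixes f :: "(nat \<Rightarrow> real) \<Rightarrow> real"
  shows "(\<Sum>\<epsilon>\<in>{..<Suc n} \<rightarrow>\<^sub>E {- 1, 1}. f \<epsilon>)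
    = (\<Sum>\<epsilon>\<in>{..<n} \<rightarrow>\<^sub>E {- 1, 1}. f (\<epsilon>(n := 1)) + f (\<epsilon>(n := - 1)))"
proof -
  have "(\<Sum>\<epsilon>\<in>{..<Suc n} \<rightarrow>\<^sub>E {- 1, 1}. f \<epsilon>)
      = (\<Sum>p\<in>{- 1, 1} \<times> ({..<n} \<rightarrow>\<^sub>E {- 1, 1}). f ((\<lambda>(y, g). g(n := y)) p))"
    unfolding lessThan_Suc PiE_insert_eq
    by (subst sum.reindex) (auto intro!: inj_combinator)
  also have "\<dots> = (\<Sum>y\<in>{- 1, 1}. \<Sum>g\<in>{..<n} \<rightarrow>\<^sub>E {- 1, 1}. f (g(n := y)))"
    by (subst sum.cartesian_product) (simp add: case_prod_unfold)
  finally show ?thesis by (simp add: sum.distrib)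
qed

lemma rademacher_average_0: "rademacher_average N p 0 x = N 0 powr p"
  by (simp add: rademacher_average_def)

lemma rademacher_average_Suc:
  "rademacher_average N p (Suc n) x =
    (\<Sum>\<epsilon>\<in>{..<n} \<rightarrow>\<^sub>E {- 1, 1}.
      (N ((\<Sum>i<n. \<epsilon> i *\<^sub>R x i) + x n) powr p + N ((\<Sum>i<n. \<epsilon> i *\<^sub>R x i) - x n) powr p) / 2) / 2 ^ n"
proof -
  have "(\<Sum>i<Suc n. (\<epsilon>(n := y)) i *\<^sub>R x i) = (\<Sum>i<n. \<epsilon> i *\<^sub>R x i) + y *\<^sub>R x n"
    for \<epsilon> :: "nat \<Rightarrow> real" and y
    by simp
  then show ?thesis
    unfolding rademacher_average_def sum_signs_Suc
    by (simp add: sum_divide_distrib add_divide_distrib)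
qed

lemma card_signs: "card ({..<n} \<rightarrow>\<^sub>E {- 1, 1 :: real}) = 2 ^ n"
  by (simp add: card_PiE numeral_2_eq_2)

text \<open>The two-point inequality is applied to the signed sum of the first \<open>n\<close>
  vectors and to \<open>x n\<close>, for fixed earlier signs. It carries no constant, so none
  accumulates in the induction.\<close>

lemma rademacher_average_le:
  assumes V: "subspace V" and zero: "N 0 = 0"
    and two: "\<And>x y. x \<in> V \<Longrightarrow> y \<in> V \<Longrightarrow>
      (N (x + y) powr p + N (x - y) powr p) / 2 \<le> N x powr p + N y powr p"
    and x: "\<And>i. i < n \<Longrightarrow> x i \<in> V"
  shows "rademacher_average N p n x \<le> (\<Sum>i<n. N (x i) powr p)"
  using x
proof (induction n)
  case 0
  then show ?case by (simp add: rademacher_average_0 zero)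
next
  case (Suc n)
  have S: "(\<Sum>i<n. \<epsilon> i *\<^sub>R x i) \<in> V" for \<epsilon>
    using Suc.prems V by (intro subspace_sum subspace_scale) auto
  have "rademacher_average N p (Suc n) x
      \<le> (\<Sum>\<epsilon>\<in>{..<n} \<rightarrow>\<^sub>E {- 1, 1}. N (\<Sum>i<n. \<epsilon> i *\<^sub>R x i) powr p + N (x n) powr p) / 2 ^ n"
    unfolding rademacher_average_Suc
    by (intro divide_right_mono sum_mono two S Suc.prems) auto
  also have "\<dots> = rademacher_average N p n x + N (x n) powr p"
    by (simp add: sum.distrib card_signs rademacher_average_def add_divide_distrib)
  also have "\<dots> \<le> (\<Sum>i<Suc n. N (x i) powr p)"
    using Suc by simp
  finally show ?case .
qed

text \<open>The constant \<open>c\<close> stands only before the new vector, while the partial sum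
  keeps coefficient 1; hence the induction does not produce powers of \<open>c\<close>.\<close>

lemma rademacher_average_ge:
  assumes V: "subspace V"
    and two: "\<And>x y. x \<in> V \<Longrightarrow> y \<in> V \<Longrightarrow>
      N x powr q + c * N y powr q \<le> (N (x + y) powr q + N (x - y) powr q) / 2"
    and x: "\<And>i. i < n \<Longrightarrow> x i \<in> V"
  shows "c * (\<Sum>i<n. N (x i) powr q) \<le> rademacher_average N q n x"
  using x
proof (induction n)
  case 0
  then show ?case by (simp add: rademacher_average_0)
next
  case (Suc n)
  have S: "(\<Sum>i<n. \<epsilon> i *\<^sub>R x i) \<in> V" for \<epsilon>
    using Suc.prems V by (intro subspace_sum subspace_scale) auto
  have "c * (\<Sum>i<Suc n. N (x i) powr q) \<le> rademacher_average N q n x + c * N (x n) powr q"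
    using Suc by (simp add: distrib_left)
  also have "\<dots> = (\<Sum>\<epsilon>\<in>{..<n} \<rightarrow>\<^sub>E {- 1, 1}. N (\<Sum>i<n. \<epsilon> i *\<^sub>R x i) powr q + c * N (x n) powr q) / 2 ^ n"
    by (simp add: sum.distrib card_signs rademacher_average_def add_divide_distrib)
  also have "\<dots> \<le> rademacher_average N q (Suc n) x"
    unfolding rademacher_average_Suc
    by (intro divide_right_mono sum_mono two S Suc.prems) auto
  finally show ?case .
qed

section \<open>Sums of finite-dimensional blocks\<close>

text \<open>Blocks are the fibres of a map \<open>\<pi>\<close> on coordinates, so the l^2-sum lives
  in \<open>nat \<Rightarrow> real\<close> without an index type for pairs.\<close>

definition block_norm :: "(nat \<Rightarrow> nat) \<Rightarrow> (nat \<Rightarrow> real) \<Rightarrow> (nat \<Rightarrow> real) \<Rightarrow> nat \<Rightarrow> real"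
  where "block_norm \<pi> r x b = lp_norm (r b) (\<pi> -` {b}) x"

definition mixed_space :: "(nat \<Rightarrow> nat) \<Rightarrow> (nat \<Rightarrow> real) \<Rightarrow> (nat \<Rightarrow> real) set"
  where "mixed_space \<pi> r = {x. summable (\<lambda>b. block_norm \<pi> r x b powr 2)}"

definition mixed_norm :: "(nat \<Rightarrow> nat) \<Rightarrow> (nat \<Rightarrow> real) \<Rightarrow> (nat \<Rightarrow> real) \<Rightarrow> real"
  where "mixed_norm \<pi> r x = (\<Sum>b. block_norm \<pi> r x b powr 2) powr (1 / 2)"

locale block_sum =
  fixes \<pi> :: "nat \<Rightarrow> nat" and r :: "nat \<Rightarrow> real"
  assumes finite_block: "finite (\<pi> -` {b})"
    and exponent_ge: "1 \<le> r b" and exponent_le: "r b \<le> 2"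
begin

abbreviation "bn \<equiv> block_norm \<pi> r"
abbreviation "Y \<equiv> mixed_space \<pi> r"
abbreviation "N \<equiv> mixed_norm \<pi> r"

lemma exponent_pos: "0 < r b"
  using exponent_ge[of b] by simp

lemma bn_nonneg [simp]: "0 \<le> bn x b"
  by (simp add: block_norm_def)

lemma bn_add: "bn (x + y) b \<le> bn x b + bn y b"
  unfolding block_norm_def plus_fun_def
  by (rule Minkowski_inequality[OF exponent_ge finite_block])

lemma bn_scale: "bn (c *\<^sub>R x) b = \<bar>c\<bar> * bn x b"
  using lp_norm_scale[OF exponent_pos, of b _ c x] by (simp add: block_norm_def scaleR_fun_def)

lemma bn_zero [simp]: "bn 0 b = 0"
  using bn_scale[of 0 0 b] by simp

lemma abs_le_bn: "\<bar>x i\<bar> \<le> bn x (\<pi> i)"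
  unfolding block_norm_def by (rule abs_le_lp_norm[OF exponent_pos finite_block]) simp

lemma N_nonneg [simp]: "0 \<le> N x"
  by (simp add: mixed_norm_def)

lemma N_powr_2: "x \<in> Y \<Longrightarrow> N x powr 2 = (\<Sum>b. bn x b powr 2)"
  by (simp add: mixed_norm_def mixed_space_def powr_powr suminf_nonneg)

lemma Y_iff: "x \<in> Y \<longleftrightarrow> summable (\<lambda>b. bn x b powr 2)"
  by (simp add: mixed_space_def)

lemma bn_le_N: "bn x b \<le> N x" if "x \<in> Y"
proof -
  have "bn x b powr 2 \<le> (\<Sum>b. bn x b powr 2)"
    using that sum_le_suminf[of "\<lambda>b. bn x b powr 2" "{b}"] by (simp add: Y_iff)
  then have "bn x b powr 2 \<le> N x powr 2" by (simp only: N_powr_2[OF that])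
  then show ?thesis by (simp add: powr_numeral)
qed

lemma abs_le_N: "\<bar>x i\<bar> \<le> N x" if "x \<in> Y"
  using abs_le_bn[of x i] bn_le_N[OF that, of "\<pi> i"] by linarith

lemma N_le_iff: "N x \<le> c \<longleftrightarrow> (\<Sum>b. bn x b powr 2) \<le> c powr 2" if "x \<in> Y" "0 \<le> c"
proof -
  have "N x \<le> c \<longleftrightarrow> N x powr 2 \<le> c powr 2"
    using that(2) by (simp add: powr_numeral)
  then show ?thesis by (simp only: N_powr_2[OF that(1)])
qed

lemma Y_boundedI:
  assumes "\<And>m. (\<Sum>b<m. bn x b powr 2) \<le> c powr 2" "0 \<le> c"
  shows "x \<in> Y" "N x \<le> c"
proof -
  show x: "x \<in> Y"
    unfolding Y_iff
    by (rule bounded_imp_summable[where B = "c powr 2"])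
      (use assms(1)[of "Suc _"] in \<open>auto simp: lessThan_Suc_atMost\<close>)
  show "N x \<le> c"
    using assms x by (simp add: N_le_iff Y_iff suminf_le_const)
qed

lemma Y_add: "x + y \<in> Y" and N_add: "N (x + y) \<le> N x + N y" if "x \<in> Y" "y \<in> Y"
proof -
  note M = Minkowski_suminf[of 2 "bn x" "bn y"]
  have s: "summable (\<lambda>b. (bn x b + bn y b) powr 2)"
    using that by (intro M) (auto simp: Y_iff)
  have le: "bn (x + y) b powr 2 \<le> (bn x b + bn y b) powr 2" for b
    by (intro powr_mono2 bn_add) auto
  show Y: "x + y \<in> Y"
    unfolding Y_iff by (rule summable_comparison_test'[OF s, of 0]) (use le in auto)
  have "N (x + y) \<le> (\<Sum>b. (bn x b + bn y b) powr 2) powr (1 / 2)"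
    unfolding mixed_norm_def using Y s
    by (intro powr_mono2 suminf_le le suminf_nonneg) (auto simp: Y_iff)
  also have "\<dots> \<le> N x + N y"
    unfolding mixed_norm_def using that by (intro M) (auto simp: Y_iff)
  finally show "N (x + y) \<le> N x + N y" .
qed

lemma bn_scale_powr_2: "bn (c *\<^sub>R x) b powr 2 = c\<^sup>2 * bn x b powr 2"
  by (simp add: bn_scale powr_mult)

lemma Y_scale: "c *\<^sub>R x \<in> Y" if "x \<in> Y"
  using that unfolding Y_iff bn_scale_powr_2 by (rule summable_mult)

lemma N_scale: "N (c *\<^sub>R x) = \<bar>c\<bar> * N x" if "x \<in> Y"
  using that unfolding mixed_norm_def bn_scale_powr_2 Y_iff
  by (simp add: suminf_mult powr_mult suminf_nonneg powr_half_sqrt)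

lemma Y_zero: "0 \<in> Y"
  by (simp add: Y_iff)

lemma N_zero [simp]: "N 0 = 0"
  by (simp add: mixed_norm_def)

lemma subspace_Y: "subspace Y"
  by (intro subspaceI Y_zero Y_add Y_scale)

lemma N_eq_0: "x = 0" if "x \<in> Y" "N x = 0"
proof
  show "x i = 0 i" for i
    using abs_le_N[OF that(1), of i] that(2) by simp
qed

lemma normed_space_Y: "normed_space Y N"
  unfolding normed_space_def
  using subspace_Y N_eq_0 N_scale N_add by auto

lemma Y_diff: "x \<in> Y \<Longrightarrow> y \<in> Y \<Longrightarrow> x - y \<in> Y"
  using subspace_Y by (rule subspace_diff)

lemma N_uminus: "x \<in> Y \<Longrightarrow> N (- x) = N x"
  using N_scale[of x "- 1"] by simp

text \<open>A block has finitely many coordinates, so coordinatewise convergence suffices for its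
  norm.\<close>

lemma tendsto_bn:
  assumes "\<And>i. (\<lambda>m. x m i) \<longlonglongrightarrow> y i"
  shows "(\<lambda>m. bn (x m) b) \<longlonglongrightarrow> bn y b"
  unfolding block_norm_def lp_norm_def
proof (intro tendsto_powr' tendsto_sum tendsto_const tendsto_rabs assms disjI2 conjI)
qed (auto simp: exponent_pos sum_nonneg)

text \<open>A Cauchy sequence converges in each coordinate because \<open>N\<close> dominates
  coordinates. The Cauchy estimate then passes to the coordinatewise limit.\<close>

lemma banach_space_Y: "banach_space Y N"
proof -
  interpret M: Metric_space Y "norm_dist Y N"
    by (rule Metric_space_norm_dist[OF normed_space_Y])
  have "\<exists>x. limitin M.mtopology \<sigma> x sequentially" if cau: "M.MCauchy \<sigma>" for \<sigma>
  proof -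
    have \<sigma>: "\<sigma> m \<in> Y" for m using cau by (auto simp: M.MCauchy_def)
    have cau': "\<exists>K. \<forall>m n. K \<le> m \<longrightarrow> K \<le> n \<longrightarrow> N (\<sigma> m - \<sigma> n) < e" if "e > 0" for e
      using cau that \<sigma> unfolding M.MCauchy_def norm_dist_def by auto
    have "Cauchy (\<lambda>m. \<sigma> m i)" for i
    proof (rule CauchyI)
      fix e :: real assume "e > 0"
      from cau'[OF this] obtain K where K: "\<And>m n. K \<le> m \<Longrightarrow> K \<le> n \<Longrightarrow> N (\<sigma> m - \<sigma> n) < e" by blast
      have "norm (\<sigma> m i - \<sigma> n i) < e" if "K \<le> m" "K \<le> n" for m n
        using K[OF that] abs_le_N[OF Y_diff[OF \<sigma> \<sigma>], of m n i] by simp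
      then show "\<exists>M. \<forall>m\<ge>M. \<forall>n\<ge>M. norm (\<sigma> m i - \<sigma> n i) < e" by blast
    qed
    then have "\<forall>i. \<exists>l. (\<lambda>m. \<sigma> m i) \<longlonglongrightarrow> l"
      by (simp add: Cauchy_convergent_iff convergent_def)
    then have "\<exists>x. \<forall>i. (\<lambda>m. \<sigma> m i) \<longlonglongrightarrow> x i"
      by (rule choice)
    then obtain x where x: "\<And>i. (\<lambda>m. \<sigma> m i) \<longlonglongrightarrow> x i" by blast
    have close: "\<exists>K. \<forall>m\<ge>K. \<sigma> m - x \<in> Y \<and> N (\<sigma> m - x) \<le> e" if "e > 0" for e
    proof -
      from cau'[OF that] obtain K where K: "\<And>m n. K \<le> m \<Longrightarrow> K \<le> n \<Longrightarrow> N (\<sigma> m - \<sigma> n) < e" by blast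
      have "\<sigma> m - x \<in> Y \<and> N (\<sigma> m - x) \<le> e" if m: "K \<le> m" for m
      proof -
        \<comment> \<open>A truncation to finitely many blocks is continuous under coordinatewise
          limits; uniformity in \<open>k\<close> removes it again.\<close>
        have "(\<Sum>b<k. bn (\<sigma> m - x) b powr 2) \<le> e powr 2" for k
        proof (rule LIMSEQ_le_const2)
          show "(\<lambda>n. \<Sum>b<k. bn (\<sigma> m - \<sigma> n) b powr 2) \<longlonglongrightarrow> (\<Sum>b<k. bn (\<sigma> m - x) b powr 2)"
            by (intro tendsto_sum tendsto_powr' tendsto_bn tendsto_const disjI2)
              (auto intro!: tendsto_intros x)
          have "(\<Sum>b<k. bn (\<sigma> m - \<sigma> n) b powr 2) \<le> e powr 2" if "K \<le> n" for n
          proof -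
            have d: "\<sigma> m - \<sigma> n \<in> Y" by (intro Y_diff \<sigma>)
            have "(\<Sum>b<k. bn (\<sigma> m - \<sigma> n) b powr 2) \<le> (\<Sum>b. bn (\<sigma> m - \<sigma> n) b powr 2)"
              using d by (intro sum_le_suminf) (auto simp: Y_iff)
            also have "\<dots> \<le> e powr 2"
              using K[OF m that] d \<open>e > 0\<close> N_le_iff[OF d, of e] by simp
            finally show ?thesis .
          qed
          then show "\<exists>M. \<forall>n\<ge>M. (\<Sum>b<k. bn (\<sigma> m - \<sigma> n) b powr 2) \<le> e powr 2" by blast
        qed
        then show ?thesis using Y_boundedI[of "\<sigma> m - x" e] \<open>e > 0\<close> by simp
      qed
      then show ?thesis by blast
    qed
    from close[of 1] obtain K where "\<sigma> K - x \<in> Y" by auto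
    then have xY: "x \<in> Y" using Y_diff[OF \<sigma>[of K], of "\<sigma> K - x"] by simp
    have "limitin M.mtopology \<sigma> x sequentially"
      unfolding M.limit_metric_sequentially
    proof (intro conjI xY allI impI)
      fix e :: real assume "0 < e"
      then obtain K where K: "\<And>m. m \<ge> K \<Longrightarrow> N (\<sigma> m - x) \<le> e / 2"
        using close[of "e / 2"] by auto
      have "norm_dist Y N (\<sigma> m) x < e" if "m \<ge> K" for m
        using K[OF that] \<open>0 < e\<close> by (simp add: norm_dist_def)
      then show "\<exists>K. \<forall>n\<ge>K. \<sigma> n \<in> Y \<and> norm_dist Y N (\<sigma> n) x < e"
        using \<sigma> by blast
    qed
    then show ?thesis by blast
  qed
  then show ?thesis
    using normed_space_Y by (auto simp: banach_space_def M.mcomplete_def)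
qed

end

section \<open>Type and cotype of the block sum\<close>

lemma lp_norm_antimono:
  assumes "0 < r" "r \<le> s" "finite A"
  shows "lp_norm s A a \<le> lp_norm r A a"
proof -
  let ?L = "lp_norm r A a"
  have "(\<Sum>i\<in>A. \<bar>a i\<bar> powr s) \<le> (\<Sum>i\<in>A. \<bar>a i\<bar> powr r * ?L powr (s - r))"
  proof (rule sum_mono)
    fix i assume "i \<in> A"
    have "\<bar>a i\<bar> powr s = \<bar>a i\<bar> powr r * \<bar>a i\<bar> powr (s - r)" by (simp flip: powr_add)
    also have "\<dots> \<le> \<bar>a i\<bar> powr r * ?L powr (s - r)"
      using assms \<open>i \<in> A\<close> by (intro mult_left_mono powr_mono2 abs_le_lp_norm) auto
    finally show "\<bar>a i\<bar> powr s \<le> \<bar>a i\<bar> powr r * ?L powr (s - r)" .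
  qed
  also have "\<dots> = ?L powr r * ?L powr (s - r)"
    by (simp only: lp_norm_powr[OF assms(1)] sum_distrib_right)
  also have "\<dots> = ?L powr s" by (simp flip: powr_add)
  finally show ?thesis using assms by (subst lp_norm_le_iff) auto
qed

text \<open>Both sides are compared with the l^1 norm. The crude factor suffices for changing the
  exponents of finitely many blocks.\<close>

lemma lp_norm_le_card_mult:
  assumes "1 \<le> r" "0 < s" "finite A"
  shows "lp_norm r A a \<le> card A * lp_norm s A a"
proof -
  have "lp_norm r A a \<le> lp_norm 1 A a" using assms by (intro lp_norm_antimono) auto
  also have "\<dots> = (\<Sum>i\<in>A. \<bar>a i\<bar>)" by (simp add: lp_norm_def sum_nonneg)
  also have "\<dots> \<le> (\<Sum>i\<in>A. lp_norm s A a)" using assms by (intro sum_mono abs_le_lp_norm) auto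
  finally show ?thesis by simp
qed

context block_sum
begin

text \<open>Both the two-point inequality and the outer norm are quadratic, so the block
  inequalities simply add up; \<open>c\<close> is a lower bound for all block constants
  \<open>r b - 1\<close>.\<close>

lemma N_two_point_convex:
  assumes c: "0 < c" "\<And>b. c \<le> r b - 1" and xy: "x \<in> Y" "y \<in> Y"
  shows "N x powr 2 + c * N y powr 2 \<le> (N (x + y) powr 2 + N (x - y) powr 2) / 2"
proof -
  have s: "summable (\<lambda>b. bn z b powr 2)" if "z \<in> Y" for z using that by (simp add: Y_iff)
  have pt: "bn x b powr 2 + c * bn y b powr 2 \<le> (bn (x + y) b powr 2 + bn (x - y) b powr 2) / 2" for b
  proof -
    have r: "1 < r b" "r b \<le> 2" using c(1) c(2)[of b] exponent_le[of b] by linarith+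
    have "c * bn y b powr 2 \<le> (r b - 1) * bn y b powr 2"
      by (intro mult_right_mono c) auto
    also have "bn x b powr 2 + \<dots> \<le> (bn (x + y) b powr 2 + bn (x - y) b powr 2) / 2"
      using lp_norm_two_point_convex[OF r, of "\<pi> -` {b}" x y]
      by (simp add: block_norm_def plus_fun_def fun_diff_def)
    finally show ?thesis by simp
  qed
  note ss = s[OF xy(1)] s[OF xy(2)] s[OF Y_add[OF xy]] s[OF Y_diff[OF xy]]
  have "N x powr 2 + c * N y powr 2 = (\<Sum>b. bn x b powr 2 + c * bn y b powr 2)"
    unfolding N_powr_2[OF xy(1)] N_powr_2[OF xy(2)]
    using ss by (subst suminf_add [symmetric]) (simp_all add: suminf_mult summable_mult)
  also have "\<dots> \<le> (\<Sum>b. (bn (x + y) b powr 2 + bn (x - y) b powr 2) / 2)"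
    using ss by (intro suminf_le pt summable_add summable_mult summable_divide)
  also have "\<dots> = (N (x + y) powr 2 + N (x - y) powr 2) / 2"
    unfolding N_powr_2[OF Y_add[OF xy]] N_powr_2[OF Y_diff[OF xy]]
    using ss by (simp add: suminf_divide summable_add suminf_add)
  finally show ?thesis .
qed

text \<open>Each block satisfies the estimate with squares on the left and \<open>p\<close>-th
  powers on the right. Summation over the blocks is Minkowski's inequality in l^(2/p) for the
  sequences \<open>bn x b powr p\<close> and \<open>bn y b powr p\<close>.\<close>

lemma N_two_point_smooth:
  assumes p: "1 \<le> p" "p \<le> 2" "\<And>b. p \<le> r b" and xy: "x \<in> Y" "y \<in> Y"
  shows "(N (x + y) powr p + N (x - y) powr p) / 2 \<le> N x powr p + N y powr p"
proof -
  have s: "summable (\<lambda>b. bn z b powr 2)" if "z \<in> Y" for z using that by (simp add: Y_iff)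
  define q where "q = 2 / p"
  have q: "q \<ge> 1" "p * q = 2" "1 / q = p / 2" using p by (auto simp: q_def)
  have pq: "(z powr p) powr q = z powr 2" for z :: real by (simp add: powr_powr q)
  have pt: "(bn (x + y) b powr 2 + bn (x - y) b powr 2) / 2 \<le> (bn x b powr p + bn y b powr p) powr q" for b
  proof -
    let ?z = "lp_norm (r b) (\<pi> -` {b}) (\<lambda>i. sqrt ((x i)\<^sup>2 + (y i)\<^sup>2))"
    have "(bn (x + y) b powr 2 + bn (x - y) b powr 2) / 2 \<le> ?z powr 2"
      using lp_norm_two_point_smooth[OF exponent_ge exponent_le, of b "\<pi> -` {b}" x y]
      by (simp add: block_norm_def plus_fun_def fun_diff_def)
    also have "\<dots> = (?z powr p) powr q" by (simp only: pq)
    also have "\<dots> \<le> (bn x b powr p + bn y b powr p) powr q"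
      unfolding block_norm_def using q p
      by (intro powr_mono2 lp_norm_two_point_concavity p(3) exponent_le finite_block) auto
    finally show ?thesis .
  qed
  note ss = s[OF xy(1)] s[OF xy(2)] s[OF Y_add[OF xy]] s[OF Y_diff[OF xy]]
  note M = Minkowski_suminf[of q "\<lambda>b. bn x b powr p" "\<lambda>b. bn y b powr p"]
  have sM: "summable (\<lambda>b. (bn x b powr p + bn y b powr p) powr q)"
    using ss by (intro M q) (auto simp only: pq powr_ge_zero)
  have Np: "(\<Sum>b. (bn z b powr p) powr q) powr (1 / q) = N z powr p" for z
    by (simp only: pq) (simp add: mixed_norm_def powr_powr q)
  have "((N (x + y) powr p + N (x - y) powr p) / 2) powr q
      = ((1 - 1 / 2) * N (x + y) powr p + 1 / 2 * N (x - y) powr p) powr q"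
    by (simp add: field_simps)
  also have "\<dots> \<le> (1 - 1 / 2) * (N (x + y) powr p) powr q + 1 / 2 * (N (x - y) powr p) powr q"
    by (intro powr_convex_combination q) auto
  also have "\<dots> = (N (x + y) powr 2 + N (x - y) powr 2) / 2"
    by (simp add: pq)
  also have "\<dots> = (\<Sum>b. (bn (x + y) b powr 2 + bn (x - y) b powr 2) / 2)"
    unfolding N_powr_2[OF Y_add[OF xy]] N_powr_2[OF Y_diff[OF xy]]
    using ss by (simp add: suminf_divide summable_add suminf_add)
  also have "\<dots> \<le> (\<Sum>b. (bn x b powr p + bn y b powr p) powr q)"
    using ss sM by (intro suminf_le pt summable_add summable_divide)
  finally have "(((N (x + y) powr p + N (x - y) powr p) / 2) powr q) powr (1 / q)
      \<le> (\<Sum>b. (bn x b powr p + bn y b powr p) powr q) powr (1 / q)"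
    using q by (intro powr_mono2) auto
  also have "\<dots> \<le> N x powr p + N y powr p"
    unfolding Np[symmetric] using ss by (intro M q) (auto simp only: pq powr_ge_zero)
  finally show ?thesis using q(1) by (simp add: powr_powr)
qed

lemma rademacher_cotype_2:
  assumes c: "0 < c" "\<And>b. c \<le> r b - 1"
  shows "rademacher_cotype Y N 2"
  unfolding rademacher_cotype_def
proof (intro conjI exI[of _ "(1 / c) powr (1 / 2)"] allI impI)
  fix n :: nat and x assume "\<forall>i<n. x i \<in> Y"
  then have "c * (\<Sum>i<n. N (x i) powr 2) \<le> rademacher_average N 2 n x"
    by (intro rademacher_average_ge[OF subspace_Y] N_two_point_convex c) auto
  then have "(\<Sum>i<n. N (x i) powr 2) \<le> 1 / c * rademacher_average N 2 n x"
    using c(1) by (simp add: field_simps)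
  then have "(\<Sum>i<n. N (x i) powr 2) powr (1 / 2) \<le> (1 / c * rademacher_average N 2 n x) powr (1 / 2)"
    by (intro powr_mono2 sum_nonneg) auto
  also have "\<dots> = (1 / c) powr (1 / 2) * rademacher_average N 2 n x powr (1 / 2)"
    by (rule powr_mult)
  finally show "(\<Sum>i<n. N (x i) powr 2) powr (1 / 2) \<le> (1 / c) powr (1 / 2) * rademacher_average N 2 n x powr (1 / 2)" .
qed (use c(1) in auto)

lemma cotype_index_eq_2:
  assumes "0 < c" "\<And>b. c \<le> r b - 1"
  shows "cotype_index Y N = 2"
  unfolding cotype_index_def
proof (rule antisym)
  show "Inf {ereal q |q. rademacher_cotype Y N q} \<le> 2"
    by (rule Inf_lower) (use rademacher_cotype_2[OF assms] in auto)
  show "2 \<le> Inf {ereal q |q. rademacher_cotype Y N q}"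
    by (rule Inf_greatest) (auto simp: rademacher_cotype_def)
qed

text \<open>
  Raising the exponents below \<open>p\<close> to \<open>p\<close> changes only finitely many finite blocks, hence gives an
  equivalent norm, and that one has type \<open>p\<close> with constant 1.
\<close>

lemma rademacher_type_less_2:
  assumes p: "1 \<le> p" "p < 2" and fin: "finite {b. r b < p}"
  shows "rademacher_type Y N p"
proof -
  define s where "s = (\<lambda>b. max (r b) p)"
  interpret M: block_sum \<pi> s
    using finite_block exponent_ge exponent_le p by unfold_locales (auto simp: s_def le_max_iff_disj)
  \<comment> \<open>The sum dominates the size of each altered block, and the summand 1 serves the
    unaltered ones.\<close>
  define K where "K = 1 + (\<Sum>b | r b < p. real (card (\<pi> -` {b})))"
  have K: "K \<ge> 1" by (auto simp: K_def intro: sum_nonneg)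
  have le1: "M.bn x b \<le> bn x b" for x b
    unfolding block_norm_def using exponent_pos by (intro lp_norm_antimono finite_block) (auto simp: s_def)
  have le2: "bn x b \<le> K * M.bn x b" for x b
  proof (cases "r b < p")
    case True
    have "bn x b \<le> card (\<pi> -` {b}) * M.bn x b"
      unfolding block_norm_def by (intro lp_norm_le_card_mult exponent_ge M.exponent_pos finite_block)
    also have "\<dots> \<le> K * M.bn x b"
    proof (rule mult_right_mono)
      show "real (card (\<pi> -` {b})) \<le> K"
        unfolding K_def using fin True
        by (intro add_increasing member_le_sum) auto
    qed auto
    finally show ?thesis .
  next
    case False
    then have "bn x b = 1 * M.bn x b" by (simp add: block_norm_def s_def)
    also have "\<dots> \<le> K * M.bn x b" by (intro mult_right_mono K) auto
    finally show ?thesis .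
  qed
  have M_Y: "x \<in> M.Y" and M_N_le: "M.N x \<le> N x" if "x \<in> Y" for x
  proof -
    have "(\<Sum>b<m. M.bn x b powr 2) \<le> N x powr 2" for m
    proof -
      have "(\<Sum>b<m. M.bn x b powr 2) \<le> (\<Sum>b<m. bn x b powr 2)"
        by (intro sum_mono powr_mono2 le1) auto
      also have "\<dots> \<le> N x powr 2"
        unfolding N_powr_2[OF that] using that by (intro sum_le_suminf) (auto simp: Y_iff)
      finally show ?thesis .
    qed
    then show "x \<in> M.Y" "M.N x \<le> N x" using M.Y_boundedI[of x "N x"] by auto
  qed
  have N_le: "N x \<le> K * M.N x" if "x \<in> Y" for x
  proof (rule Y_boundedI)
    fix m
    have "(\<Sum>b<m. bn x b powr 2) \<le> (\<Sum>b<m. (K * M.bn x b) powr 2)"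
      by (intro sum_mono powr_mono2 le2) auto
    also have "\<dots> = K powr 2 * (\<Sum>b<m. M.bn x b powr 2)"
      using K by (simp add: powr_mult sum_distrib_left)
    also have "\<dots> \<le> K powr 2 * M.N x powr 2"
      unfolding M.N_powr_2[OF M_Y[OF that]] using M_Y[OF that]
      by (intro mult_left_mono sum_le_suminf) (auto simp: M.Y_iff)
    also have "\<dots> = (K * M.N x) powr 2" using K by (simp add: powr_mult)
    finally show "(\<Sum>b<m. bn x b powr 2) \<le> (K * M.N x) powr 2" .
  qed (use K in auto)
  show ?thesis
    unfolding rademacher_type_def
  proof (intro conjI exI[of _ K] allI impI)
    fix n :: nat and x assume x: "\<forall>i<n. x i \<in> Y"
    have S: "(\<Sum>i<n. \<epsilon> i *\<^sub>R x i) \<in> Y" for \<epsilon>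
      using x subspace_Y by (intro subspace_sum subspace_scale) auto
    have "rademacher_average N p n x \<le> (\<Sum>\<epsilon>\<in>{..<n} \<rightarrow>\<^sub>E {- 1, 1}. K powr p * M.N (\<Sum>i<n. \<epsilon> i *\<^sub>R x i) powr p) / 2 ^ n"
      unfolding rademacher_average_def
    proof (intro divide_right_mono sum_mono)
      fix \<epsilon> :: "nat \<Rightarrow> real"
      have "N (\<Sum>i<n. \<epsilon> i *\<^sub>R x i) powr p \<le> (K * M.N (\<Sum>i<n. \<epsilon> i *\<^sub>R x i)) powr p"
        using p by (intro powr_mono2 N_le S) auto
      then show "N (\<Sum>i<n. \<epsilon> i *\<^sub>R x i) powr p \<le> K powr p * M.N (\<Sum>i<n. \<epsilon> i *\<^sub>R x i) powr p"
        using K by (simp add: powr_mult)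
    qed simp
    also have "\<dots> = K powr p * rademacher_average M.N p n x"
      by (simp add: rademacher_average_def flip: sum_distrib_left)
    also have "rademacher_average M.N p n x \<le> (\<Sum>i<n. M.N (x i) powr p)"
    proof (rule rademacher_average_le[of M.Y M.N, OF M.subspace_Y M.N_zero])
      have "p \<le> s b" for b by (simp add: s_def)
      then show "(M.N (u + v) powr p + M.N (u - v) powr p) / 2 \<le> M.N u powr p + M.N v powr p"
        if "u \<in> M.Y" "v \<in> M.Y" for u v
        using that p by (intro M.N_two_point_smooth) auto
    qed (use x M_Y in auto)
    also have "\<dots> \<le> (\<Sum>i<n. N (x i) powr p)"
      using p x by (intro sum_mono powr_mono2 M_N_le) auto
    finally have "rademacher_average N p n x \<le> K powr p * (\<Sum>i<n. N (x i) powr p)"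
      by (simp add: mult_left_mono)
    then have "rademacher_average N p n x powr (1 / p) \<le> (K powr p * (\<Sum>i<n. N (x i) powr p)) powr (1 / p)"
      using p by (intro powr_mono2) (auto simp: rademacher_average_def sum_nonneg)
    also have "\<dots> = K * (\<Sum>i<n. N (x i) powr p) powr (1 / p)"
      using p K by (simp add: powr_mult powr_powr sum_nonneg)
    finally show "rademacher_average N p n x powr (1 / p) \<le> K * (\<Sum>i<n. N (x i) powr p) powr (1 / p)" .
  qed (use p K in auto)
qed

text \<open>Type \<open>p\<close> is available for each \<open>p < 2\<close>, with a constant
  depending on \<open>p\<close>. This already determines the supremum, attained or not.\<close>

lemma type_index_eq_2:
  assumes "\<And>p. p < 2 \<Longrightarrow> finite {b. r b < p}"
  shows "type_index Y N = 2"
  unfolding type_index_def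
proof (rule antisym)
  show "Sup {ereal p |p. rademacher_type Y N p} \<le> 2"
    by (rule Sup_least) (auto simp: rademacher_type_def)
  show "2 \<le> Sup {ereal p |p. rademacher_type Y N p}"
  proof (rule dense_le)
    fix y :: ereal assume y: "y < 2"
    obtain p where p: "y \<le> ereal p" "1 \<le> p" "p < 2"
    proof (cases y)
      case (real t)
      then show ?thesis using y by (intro that[of "max t 1"]) auto
    next
      case MInf
      then show ?thesis by (intro that[of 1]) auto
    qed (use y in auto)
    have "y \<le> ereal p" by fact
    also have "\<dots> \<le> Sup {ereal p |p. rademacher_type Y N p}"
      using rademacher_type_less_2[OF p(2,3) assms[OF p(3)]] by (intro Sup_upper) auto
    finally show "y \<le> Sup {ereal p |p. rademacher_type Y N p}" .
  qed
qed

end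

section \<open>Finite rank, compactness and signs\<close>

text \<open>A finite-dimensional space of functions is determined by finitely many evaluations. When
  \<open>b\<close> is added, \<open>v\<close> is its part missed by the current reconstruction
  \<open>P\<close>; if \<open>v\<close> is nonzero, one further evaluation point detects it.\<close>

lemma span_coordinates:
  fixes B :: "('a \<Rightarrow> real) set"
  assumes "finite B"
  shows "\<exists>J u. finite J \<and> (\<forall>j. u j \<in> span B) \<and> (\<forall>x\<in>span B. x = (\<Sum>j\<in>J. x j *\<^sub>R u j))"
  using assms
proof (induction B)
  case empty
  show ?case by (rule exI[of _ "{}"], rule exI[of _ "\<lambda>_. 0"]) (simp add: zero_fun_def)
next
  case (insert b B)
  then obtain J u where J: "finite J" and u: "\<And>j. u j \<in> span B"
    and eq: "\<And>x. x \<in> span B \<Longrightarrow> x = (\<Sum>j\<in>J. x j *\<^sub>R u j)" by blast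
  define P where "P = (\<lambda>x :: 'a \<Rightarrow> real. \<Sum>j\<in>J. x j *\<^sub>R u j)"
  have P_add: "P (x + y) = P x + P y" and P_scale: "P (c *\<^sub>R x) = c *\<^sub>R P x" for x y c
    by (simp_all add: P_def scaleR_add_left sum.distrib scaleR_sum_right)
  have P_span: "P x \<in> span B" for x
    unfolding P_def by (intro span_sum span_scale u)
  have mono: "x \<in> span B \<Longrightarrow> x \<in> span (insert b B)" for x
    using span_mono[of B "insert b B"] by blast
  define v where "v = b - P b"
  have v: "v \<in> span (insert b B)"
    unfolding v_def by (intro span_diff mono P_span span_base) simp
  have decomp: "\<exists>c. x = P x + c *\<^sub>R v" if "x \<in> span (insert b B)" for x
  proof -
    from that obtain c where "x - c *\<^sub>R b \<in> span B" by (auto simp: span_insert)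
    then have "x - c *\<^sub>R b = P (x - c *\<^sub>R b)" using eq P_def by blast
    also have "\<dots> = P x - c *\<^sub>R P b" using P_add[of x "- c *\<^sub>R b"] P_scale[of "- c" b] by simp
    finally have "x = P x + c *\<^sub>R v" by (simp add: v_def algebra_simps)
    then show ?thesis by blast
  qed
  show ?case
  proof (cases "v = 0")
    case True
    show ?thesis
    proof (intro exI[of _ J] exI[of _ u] conjI allI ballI)
      show "x = (\<Sum>j\<in>J. x j *\<^sub>R u j)" if "x \<in> span (insert b B)" for x
        using decomp[OF that] True unfolding P_def by (metis add_0_right scaleR_zero_right)
    qed (use J u mono in auto)
  next
    case False
    then obtain k where k: "v k \<noteq> 0" by (auto simp: fun_eq_iff)
    \<comment> \<open>The coefficient of \<open>v\<close> in \<open>x\<close> is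
      \<open>(x k - P x k) / v k\<close>; \<open>u'\<close> results from collecting terms by
      coordinates of \<open>x\<close>. The two summands also cover the case that \<open>k\<close>
      already lies in \<open>J\<close>.\<close>
    define u' where "u' = (\<lambda>j. (if j \<in> J then u j - (u j k / v k) *\<^sub>R v else 0) + (if j = k then (1 / v k) *\<^sub>R v else 0))"
    have eqx: "x = (\<Sum>j\<in>insert k J. x j *\<^sub>R u' j)" if x: "x \<in> span (insert b B)" for x
    proof -
      obtain c where c: "x = P x + c *\<^sub>R v" using decomp[OF x] by blast
      have "x k = P x k + c * v k" using c by (metis plus_fun_apply scaleR_fun_apply real_scaleR_def)
      then have c': "c = x k / v k - P x k / v k" using k by (simp add: field_simps)
      have Pk: "P x k = (\<Sum>j\<in>J. x j * u j k)"
        unfolding P_def by (induction J rule: infinite_finite_induct) auto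
      have "(\<Sum>j\<in>insert k J. x j *\<^sub>R u' j)
          = (\<Sum>j\<in>insert k J. x j *\<^sub>R (if j \<in> J then u j - (u j k / v k) *\<^sub>R v else 0))
          + (\<Sum>j\<in>insert k J. x j *\<^sub>R (if j = k then (1 / v k) *\<^sub>R v else 0))"
        unfolding u'_def by (simp only: scaleR_add_right sum.distrib)
      also have "(\<Sum>j\<in>insert k J. x j *\<^sub>R (if j = k then (1 / v k) *\<^sub>R v else 0)) = (x k / v k) *\<^sub>R v"
        using J by (simp add: if_distrib sum.delta cong: if_cong)
      also have "(\<Sum>j\<in>insert k J. x j *\<^sub>R (if j \<in> J then u j - (u j k / v k) *\<^sub>R v else 0))
          = (\<Sum>j\<in>J. x j *\<^sub>R (u j - (u j k / v k) *\<^sub>R v))"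
        using J by (intro sum.mono_neutral_cong_right) auto
      also have "\<dots> = P x - (P x k / v k) *\<^sub>R v"
      proof -
        have "(P x k / v k) *\<^sub>R v = (\<Sum>j\<in>J. (x j * u j k / v k) *\<^sub>R v)"
          unfolding Pk by (simp only: sum_divide_distrib scaleR_sum_left)
        then show ?thesis by (simp add: P_def scaleR_diff_right sum_subtractf)
      qed
      also have "P x - (P x k / v k) *\<^sub>R v + (x k / v k) *\<^sub>R v = P x + c *\<^sub>R v"
        unfolding c' scaleR_diff_left by (simp only: algebra_simps)
      finally show ?thesis using c by metis
    qed
    have u': "u' j \<in> span (insert b B)" for j
      unfolding u'_def using u mono v
      by (intro span_add) (auto intro!: span_diff span_scale span_zero)
    show ?thesis
    proof (intro exI[of _ "insert k J"] exI[of _ u'] conjI allI ballI)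
      show "finite (insert k J)" using J by simp
      show "u' j \<in> span (insert b B)" for j by (rule u')
      show "x = (\<Sum>j\<in>insert k J. x j *\<^sub>R u' j)" if "x \<in> span (insert b B)" for x
        using that by (rule eqx)
    qed
  qed
qed

text \<open>The spanning set is replaced by a basis taken from the range of \<open>T\<close>, so
  that the vectors \<open>u j\<close> inherit membership in subspaces containing the range.\<close>

lemma finite_rank_coordinates:
  fixes T :: "('a \<Rightarrow> real) \<Rightarrow> 'a \<Rightarrow> real"
  assumes "finite_rank_on V T"
  obtains J u where "finite J" "\<And>j. u j \<in> span (T ` V)"
    "\<And>x. x \<in> V \<Longrightarrow> T x = (\<Sum>j\<in>J. T x j *\<^sub>R u j)"
proof -
  from assms obtain B where B: "finite B" "T ` V \<subseteq> span B" by (auto simp: finite_rank_on_def)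
  obtain B' where B': "B' \<subseteq> T ` V" "independent B'" "T ` V \<subseteq> span B'"
    using maximal_independent_subset by blast
  have "finite B'" using independent_span_bound[OF B(1) B'(2)] B'(1) B(2) by auto
  from span_coordinates[OF this] obtain J u where
    "finite J" "\<And>j. u j \<in> span B'" "\<And>x. x \<in> span B' \<Longrightarrow> x = (\<Sum>j\<in>J. x j *\<^sub>R u j)" by blast
  then show ?thesis
    using B' span_mono[OF B'(1)] by (intro that[of J u]) blast+
qed

text \<open>Averaging the quadratic form over random signs leaves its diagonal. The induction makes
  the choice explicit: each new sign renders its cross terms nonnegative.\<close>

lemma exists_signs_diagonal_le:
  fixes a :: "'a \<Rightarrow> 'a \<Rightarrow> real"
  assumes "finite B"
  shows "\<exists>\<theta>. (\<forall>u. \<theta> u \<in> {- 1, 1}) \<and> (\<Sum>u\<in>B. a u u) \<le> (\<Sum>u\<in>B. \<Sum>v\<in>B. \<theta> u * \<theta> v * a u v)"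
  using assms
proof (induction B)
  case empty
  show ?case by (intro exI[of _ "\<lambda>_. 1"]) simp
next
  case (insert w B)
  then obtain \<theta> where \<theta>: "\<And>u. \<theta> u \<in> {- 1, 1}"
    and le: "(\<Sum>u\<in>B. a u u) \<le> (\<Sum>u\<in>B. \<Sum>v\<in>B. \<theta> u * \<theta> v * a u v)" by blast
  define c where "c = (\<Sum>v\<in>B. \<theta> v * a w v) + (\<Sum>u\<in>B. \<theta> u * a u w)"
  define s :: real where "s = (if c \<ge> 0 then 1 else - 1)"
  define \<theta>' where "\<theta>' = \<theta>(w := s)"
  have "s * c \<ge> 0" "s * s = 1" by (auto simp: s_def)
  have \<theta>': "\<theta>' u = \<theta> u" if "u \<in> B" for u using that insert.hyps by (auto simp: \<theta>'_def)
  have "(\<Sum>u\<in>insert w B. \<Sum>v\<in>insert w B. \<theta>' u * \<theta>' v * a u v)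
      = a w w + s * c + (\<Sum>u\<in>B. \<Sum>v\<in>B. \<theta> u * \<theta> v * a u v)"
  proof -
    have "(\<Sum>u\<in>insert w B. \<Sum>v\<in>insert w B. \<theta>' u * \<theta>' v * a u v)
        = s * s * a w w + (\<Sum>v\<in>B. s * \<theta> v * a w v) + ((\<Sum>u\<in>B. \<theta> u * s * a u w) + (\<Sum>u\<in>B. \<Sum>v\<in>B. \<theta> u * \<theta> v * a u v))"
      using insert.hyps \<theta>' by (simp add: sum.distrib) (simp add: \<theta>'_def)
    also have "(\<Sum>v\<in>B. s * \<theta> v * a w v) = s * (\<Sum>v\<in>B. \<theta> v * a w v)"
      by (simp add: sum_distrib_left mult.assoc)
    also have "(\<Sum>u\<in>B. \<theta> u * s * a u w) = s * (\<Sum>u\<in>B. \<theta> u * a u w)"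
      by (simp add: sum_distrib_left mult_ac)
    finally show ?thesis using \<open>s * s = 1\<close> by (simp add: c_def distrib_left)
  qed
  moreover have "\<theta>' u \<in> {- 1, 1}" for u using \<theta> by (auto simp: \<theta>'_def s_def)
  ultimately show ?case
    using le insert.hyps \<open>s * c \<ge> 0\<close> by (intro exI[of _ \<theta>']) auto
qed

section \<open>Criteria for compact and closed sets\<close>

text \<open>A member of the cover around 0 contains a ball, which leaves only finitely many points
  to cover.\<close>

lemma compactin_null_set:
  assumes V: "normed_space V N" and K: "K \<subseteq> V" "0 \<in> K"
    and fin: "\<And>e. 0 < e \<Longrightarrow> finite {x \<in> K. e \<le> N x}"
  shows "compactin (norm_topology V N) K"
proof -
  interpret M: Metric_space V "norm_dist V N"
    by (rule Metric_space_norm_dist[OF V])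
  have sym: "N (- x) = N x" if "x \<in> V" for x
    using V that unfolding normed_space_def by (metis abs_minus_cancel abs_one mult_1 scaleR_minus1_left)
  show ?thesis
    unfolding norm_topology_def compactin_def
  proof (intro conjI allI impI)
    show "K \<subseteq> topspace M.mtopology" using K by simp
    fix U assume U: "Ball U (openin M.mtopology) \<and> K \<subseteq> \<Union>U"
    then obtain A where A: "A \<in> U" "0 \<in> A" using K by blast
    then have "openin M.mtopology A" using U by blast
    then obtain e where e: "e > 0" "M.mball 0 e \<subseteq> A"
      using A(2) unfolding M.openin_mtopology by blast
    define F where "F = {x \<in> K. e \<le> N x}"
    have "\<forall>x\<in>F. \<exists>C\<in>U. x \<in> C" using U by (auto simp: F_def)
    then obtain C where C: "\<And>x. x \<in> F \<Longrightarrow> C x \<in> U \<and> x \<in> C x" by metis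
    have "x \<in> A" if "x \<in> K" "x \<notin> F" for x
    proof -
      have "x \<in> M.mball 0 e"
        using that K sym by (auto simp: F_def norm_dist_def)
      then show ?thesis using e by blast
    qed
    then have "K \<subseteq> \<Union>(insert A (C ` F))" using C by blast
    moreover have "finite (insert A (C ` F))" using fin[OF e(1)] by (simp add: F_def)
    moreover have "insert A (C ` F) \<subseteq> U" using A C by blast
    ultimately show "\<exists>\<F>. finite \<F> \<and> \<F> \<subseteq> U \<and> K \<subseteq> \<Union>\<F>" by blast
  qed
qed

text \<open>A point with \<open>\<phi> i x \<noteq> 0\<close> has distance at least
  \<open>\<bar>\<phi> i x\<bar> / C\<close> from the kernel of \<open>\<phi> i\<close>.\<close>

lemma closedin_kernels:
  fixes \<phi> :: "'i \<Rightarrow> 'a::real_vector \<Rightarrow> real"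
  assumes V: "normed_space V N"
    and diff: "\<And>i x y. x \<in> V \<Longrightarrow> y \<in> V \<Longrightarrow> \<phi> i (x - y) = \<phi> i x - \<phi> i y"
    and bd: "\<And>i x. x \<in> V \<Longrightarrow> \<bar>\<phi> i x\<bar> \<le> C * N x" and C: "C > 0"
  shows "closedin (norm_topology V N) {x \<in> V. \<forall>i. \<phi> i x = 0}"
proof -
  interpret M: Metric_space V "norm_dist V N"
    by (rule Metric_space_norm_dist[OF V])
  have V0: "subspace V" using V by (simp add: normed_space_def)
  show ?thesis
    unfolding norm_topology_def M.closedin_metric
  proof (intro conjI allI impI)
    fix x assume "x \<in> V - {x \<in> V. \<forall>i. \<phi> i x = 0}"
    then obtain i where x: "x \<in> V" "\<phi> i x \<noteq> 0" by blast
    show "\<exists>e>0. disjnt {x \<in> V. \<forall>i. \<phi> i x = 0} (M.mball x e)"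
    proof (intro exI[of _ "\<bar>\<phi> i x\<bar> / C"] conjI)
      show "disjnt {x \<in> V. \<forall>i. \<phi> i x = 0} (M.mball x (\<bar>\<phi> i x\<bar> / C))"
      proof (rule ccontr)
        assume "\<not> ?thesis"
        then obtain y where y: "y \<in> V" "\<phi> i y = 0" "N (x - y) < \<bar>\<phi> i x\<bar> / C"
          by (auto simp: disjnt_iff norm_dist_def)
        have "\<bar>\<phi> i x\<bar> \<le> C * N (x - y)"
          using bd[OF subspace_diff[OF V0 x(1) y(1)], of i] diff[OF x(1) y(1), of i] y(2) by simp
        also have "\<dots> < \<bar>\<phi> i x\<bar>" using y(3) C by (simp add: field_simps)
        finally show False by simp
      qed
    qed (use x C in auto)
  qed auto
qed

context block_sum
begin

text \<open>The block norms of \<open>x\<close> tend to 0 and each block is finite.\<close>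

lemma finite_large_coordinates:
  assumes "x \<in> Y" "0 < e"
  shows "finite {i. e \<le> \<bar>x i\<bar>}"
proof -
  have "(\<lambda>b. bn x b powr 2) \<longlonglongrightarrow> 0"
    using assms(1) unfolding Y_iff by (rule summable_LIMSEQ_zero)
  then have "eventually (\<lambda>b. bn x b powr 2 < e powr 2) sequentially"
    by (rule order_tendstoD) (use assms(2) in auto)
  then obtain m where m: "\<And>b. b \<ge> m \<Longrightarrow> bn x b powr 2 < e powr 2"
    by (auto simp: eventually_sequentially)
  have "\<pi> i < m" if "e \<le> \<bar>x i\<bar>" for i
  proof (rule ccontr)
    assume "\<not> ?thesis"
    then have "bn x (\<pi> i) powr 2 < e powr 2" by (intro m) simp
    moreover have "e powr 2 \<le> bn x (\<pi> i) powr 2"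
      using that abs_le_bn[of x i] assms(2) by (intro powr_mono2) auto
    ultimately show False by simp
  qed
  then have "{i. e \<le> \<bar>x i\<bar>} \<subseteq> (\<Union>b<m. \<pi> -` {b})" by auto
  moreover have "finite (\<Union>b<m. \<pi> -` {b})" by (simp add: finite_block)
  ultimately show ?thesis by (rule finite_subset)
qed

lemma normed_space_subset:
  assumes "subspace Z" "Z \<subseteq> Y"
  shows "normed_space Z N"
  using assms N_eq_0 N_scale N_add unfolding normed_space_def by (auto simp: subset_iff)

text \<open>Each block meets at most one of the unit vectors, so the inner exponents have no
  influence and only the outer l^2 norm is seen.\<close>

lemma N_signed_units_le:
  fixes \<theta> :: "'a \<Rightarrow> real" and g :: "'a \<Rightarrow> nat"
  assumes B: "finite B" and inj: "inj_on (\<lambda>u. \<pi> (g u)) B" and \<theta>: "\<And>u. u \<in> B \<Longrightarrow> \<bar>\<theta> u\<bar> \<le> 1"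
  shows "(\<Sum>u\<in>B. \<theta> u *\<^sub>R (\<lambda>i. of_bool (i = g u))) \<in> Y"
    and "N (\<Sum>u\<in>B. \<theta> u *\<^sub>R (\<lambda>i. of_bool (i = g u))) \<le> sqrt (card B)"
proof -
  define x where "x = (\<Sum>u\<in>B. \<theta> u *\<^sub>R (\<lambda>i. of_bool (i = g u) :: real))"
  have x_apply: "x i = (\<Sum>u\<in>B. \<theta> u * of_bool (i = g u))" for i
    unfolding x_def by (induction B rule: infinite_finite_induct) auto
  have bn_x: "bn x b \<le> of_bool (b \<in> (\<lambda>u. \<pi> (g u)) ` B)" for b
  proof (cases "b \<in> (\<lambda>u. \<pi> (g u)) ` B")
    case True
    then obtain u where u: "u \<in> B" "b = \<pi> (g u)" by blast
    have "x i = \<theta> u * of_bool (i = g u)" if "\<pi> i = b" for i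
    proof -
      have "x i = (\<Sum>v\<in>{u}. \<theta> v * of_bool (i = g v))"
        unfolding x_apply using B u that inj
        by (intro sum.mono_neutral_right) (auto dest: inj_onD)
      then show ?thesis by simp
    qed
    then have "(\<Sum>i\<in>\<pi> -` {b}. \<bar>x i\<bar> powr r b) = (\<Sum>i\<in>\<pi> -` {b}. \<bar>\<theta> u * of_bool (i = g u)\<bar> powr r b)"
      by (intro sum.cong) auto
    also have "\<dots> = (\<Sum>i\<in>\<pi> -` {b}. if i = g u then \<bar>\<theta> u\<bar> powr r b else 0)"
      using exponent_pos by (intro sum.cong) auto
    also have "\<dots> = \<bar>\<theta> u\<bar> powr r b" using u finite_block[of b] by simp
    also have "\<dots> \<le> 1 powr r b" using \<theta>[OF u(1)] exponent_pos[of b] by (intro powr_mono2) auto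
    finally show ?thesis
      using True unfolding block_norm_def by (subst lp_norm_le_iff) (auto simp: exponent_pos)
  next
    case False
    then have "x i = 0" if "\<pi> i = b" for i
      unfolding x_apply using that by (intro sum.neutral) auto
    then show ?thesis
      using False lp_norm_eq_0_iff[OF exponent_pos finite_block, of b b x]
      by (simp add: block_norm_def)
  qed
  have "(\<Sum>b<m. bn x b powr 2) \<le> sqrt (card B) powr 2" for m
  proof -
    have "(\<Sum>b<m. bn x b powr 2) \<le> (\<Sum>b<m. of_bool (b \<in> (\<lambda>u. \<pi> (g u)) ` B))"
    proof (rule sum_mono)
      fix b
      have "bn x b powr 2 \<le> of_bool (b \<in> (\<lambda>u. \<pi> (g u)) ` B) powr 2"
        by (intro powr_mono2 bn_x) auto
      also have "\<dots> = of_bool (b \<in> (\<lambda>u. \<pi> (g u)) ` B)" by (simp add: of_bool_def)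
      finally show "bn x b powr 2 \<le> of_bool (b \<in> (\<lambda>u. \<pi> (g u)) ` B)" .
    qed
    also have "\<dots> = card ({..<m} \<inter> (\<lambda>u. \<pi> (g u)) ` B)"
      by (simp add: Int_def)
    also have "\<dots> \<le> card ((\<lambda>u. \<pi> (g u)) ` B)"
      using B by (simp add: card_mono)
    also have "\<dots> \<le> card B" using B by (simp add: card_image_le)
    finally show ?thesis by simp
  qed
  then have "x \<in> Y" "N x \<le> sqrt (card B)" by (rule Y_boundedI; simp)+
  then show "(\<Sum>u\<in>B. \<theta> u *\<^sub>R (\<lambda>i. of_bool (i = g u))) \<in> Y"
    "N (\<Sum>u\<in>B. \<theta> u *\<^sub>R (\<lambda>i. of_bool (i = g u))) \<le> sqrt (card B)"
    by (simp_all only: x_def)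
qed

end

section \<open>Words and blocks\<close>

text \<open>
  The position of a letter is the number of letters after it, so that positions do not change when
  letters are put in front. A block consists of the words \<open>a # b # w\<close> with \<open>a\<close>, \<open>b\<close> and the letters of
  \<open>w\<close> outside \<open>slots a b (length w)\<close> prescribed. The twelve residues keep these sets disjoint for
  different \<open>(a, b)\<close> and for words whose lengths differ by one or two.
\<close>

fun clear_slots :: "nat set \<Rightarrow> bool list \<Rightarrow> bool list" where
  "clear_slots S [] = []"
| "clear_slots S (x # u) = (x \<and> length u \<notin> S) # clear_slots S u"

definition slots :: "bool \<Rightarrow> bool \<Rightarrow> nat \<Rightarrow> nat set"
  where "slots a b n = {t. t mod 12 = 4 * (n mod 3) + 2 * of_bool a + of_bool b}"

fun block_key :: "bool list \<Rightarrow> bool list" where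
  "block_key (a # b # u) = a # b # clear_slots (slots a b (length u)) u"
| "block_key u = u"

lemma length_clear_slots [simp]: "length (clear_slots S u) = length u"
  by (induction u) auto

lemma length_block_key [simp]: "length (block_key u) = length u"
  by (cases u rule: block_key.cases) auto

lemma clear_slots_length_eq: "clear_slots S u = clear_slots S v \<Longrightarrow> length u = length v"
  by (metis length_clear_slots)

text \<open>Disjointness of the two sets means that every letter survives at least one of the two
  clearings.\<close>

lemma clear_slots_inject:
  assumes "clear_slots S u = clear_slots S v" "clear_slots S' u = clear_slots S' v" "S \<inter> S' = {}"
  shows "u = v"
proof -
  have "length u = length v" using assms(1) by (rule clear_slots_length_eq)
  then show ?thesis using assms
  proof (induction u v rule: list_induct2)
    case (Cons x u y v)
    then have "length v \<notin> S \<or> length v \<notin> S'" by blast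
    then show ?case using Cons by auto
  qed simp
qed

text \<open>The residue \<open>4 * (n mod 3) + 2 * of_bool a + of_bool b\<close> encodes the triple
  injectively.\<close>

lemma slots_disjoint: "(a, b, n mod 3) \<noteq> (a', b', n' mod 3) \<Longrightarrow> slots a b n \<inter> slots a' b' n' = {}"
proof -
  have *: "x = y \<and> a = a' \<and> b = b'"
    if "4 * x + 2 * of_bool a + of_bool b = 4 * y + 2 * of_bool a' + (of_bool b' :: nat)" for x y :: nat
    using that by (cases a; cases b; cases a'; cases b'; simp; presburger)
  show "slots a b n \<inter> slots a' b' n' = {}" if "(a, b, n mod 3) \<noteq> (a', b', n' mod 3)"
  proof (rule ccontr)
    assume "slots a b n \<inter> slots a' b' n' \<noteq> {}"
    then obtain t where "t \<in> slots a b n" "t \<in> slots a' b' n'" by blast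
    then have "4 * (n mod 3) + 2 * of_bool a + of_bool b = 4 * (n' mod 3) + 2 * of_bool a' + (of_bool b' :: nat)"
      unfolding slots_def mem_Collect_eq by (rule subst)
    from *[OF this] show False using that by blast
  qed
qed

text \<open>Each position in \<open>S\<close> leaves one letter free, and all other letters are
  determined. The front letter of \<open>x # u\<close> has position \<open>length u\<close>.\<close>

lemma card_clear_slots_fibre:
  "finite {v. clear_slots S v = clear_slots S u}"
  "card {v. clear_slots S v = clear_slots S u} = 2 ^ card (S \<inter> {..<length u})"
proof -
  have "finite {v. clear_slots S v = clear_slots S u} \<and>
    card {v. clear_slots S v = clear_slots S u} = 2 ^ card (S \<inter> {..<length u})"
  proof (induction u)
    case Nil
    have "{v. clear_slots S v = []} = {[]}" by (auto dest: arg_cong[where f = length])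
    then show ?case by simp
  next
    case (Cons x u)
    let ?F = "{v. clear_slots S v = clear_slots S u}"
    let ?X = "if length u \<in> S then UNIV else {x}"
    have "{v. clear_slots S v = clear_slots S (x # u)} = (\<lambda>(y, v). y # v) ` (?X \<times> ?F)"
    proof (intro set_eqI iffI)
      fix v assume v: "v \<in> {v. clear_slots S v = clear_slots S (x # u)}"
      then obtain y v' where "v = y # v'" by (cases v) auto
      then show "v \<in> (\<lambda>(y, v). y # v) ` (?X \<times> ?F)"
        using v clear_slots_length_eq[of S v' u] by (auto split: if_splits)
    next
      fix v assume "v \<in> (\<lambda>(y, v). y # v) ` (?X \<times> ?F)"
      then obtain p where "v = (\<lambda>(y, v). y # v) p" and p: "p \<in> ?X \<times> ?F" by blast
      moreover define y v' where "y = fst p" and "v' = snd p"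
      ultimately have v: "v = y # v'" "y \<in> ?X" "clear_slots S v' = clear_slots S u"
        by (simp_all only: case_prod_unfold mem_Times_iff mem_Collect_eq)
      then have "length v' = length u" by (intro clear_slots_length_eq)
      then show "v \<in> {v. clear_slots S v = clear_slots S (x # u)}"
        using v by (auto split: if_splits)
    qed
    note eq = this
    have inj: "inj_on (\<lambda>(y, v). y # v) (?X \<times> ?F)" by (auto simp: inj_on_def)
    have card: "card {v. clear_slots S v = clear_slots S (x # u)} = card ?X * card ?F"
      by (simp only: eq card_image[OF inj] card_cartesian_product)
    have fin: "finite {v. clear_slots S v = clear_slots S (x # u)}"
      unfolding eq using Cons by (intro finite_imageI finite_cartesian_product) auto
    have "S \<inter> {..<length (x # u)} = (if length u \<in> S then insert (length u) (S \<inter> {..<length u}) else S \<inter> {..<length u})"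
      by (auto simp: less_Suc_eq)
    then have Suc: "card (S \<inter> {..<length (x # u)}) = (if length u \<in> S then 1 else 0) + card (S \<inter> {..<length u})"
      by simp
    show ?case
      unfolding card Suc using fin Cons by (cases "length u \<in> S") simp_all
  qed
  then show "finite {v. clear_slots S v = clear_slots S u}"
    "card {v. clear_slots S v = clear_slots S u} = 2 ^ card (S \<inter> {..<length u})" by auto
qed

lemma card_slots_ge: "n div 12 \<le> card (slots a b m \<inter> {..<n})"
proof -
  define k :: nat where "k = 4 * (m mod 3) + 2 * of_bool a + of_bool b"
  have k: "k < 12" using mod_less_divisor[of 3 m] unfolding k_def by (cases a; cases b; simp)
  have "(\<lambda>j. 12 * j + k) ` {..<n div 12} \<subseteq> slots a b m \<inter> {..<n}"
    using k by (auto simp: slots_def k_def[symmetric])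
  moreover have "card ((\<lambda>j. 12 * j + k) ` {..<n div 12}) = n div 12"
    by (subst card_image) (auto simp: inj_on_def)
  ultimately show ?thesis
    by (metis card_mono finite_Int finite_lessThan)
qed

lemma finite_words: "finite {w :: bool list. length w = n}"
  using finite_lists_length_eq[of "UNIV :: bool set" n] by simp

lemma card_words: "card {w :: bool list. length w = n} = 2 ^ n"
  using card_lists_length_eq[of "UNIV :: bool set" n] by simp

lemma sum_words_Suc:
  fixes f :: "bool list \<Rightarrow> 'a::comm_monoid_add"
  shows "(\<Sum>w | length w = Suc n. f w) = (\<Sum>w | length w = n. f (False # w) + f (True # w))"
proof -
  have "(\<Sum>w | length w = Suc n. f w) = (\<Sum>(a, w)\<in>UNIV \<times> {w. length w = n}. f (a # w))"
    by (rule sum.reindex_bij_witness[of _ "\<lambda>(a, w). a # w" "\<lambda>w. (hd w, tl w)"])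
      (auto simp: length_Suc_conv)
  also have "\<dots> = (\<Sum>a\<in>UNIV. \<Sum>w | length w = n. f (a # w))"
    by (simp add: sum.cartesian_product)
  finally show ?thesis by (simp add: UNIV_bool sum.distrib)
qed

section \<open>Coordinates and exponents indexed by words\<close>

definition code_word :: "bool list \<Rightarrow> nat"
  where "code_word = to_nat_on UNIV"

lemma bij_code_word: "bij code_word"
  unfolding code_word_def by (rule to_nat_on_infinite) (auto simp: infinite_UNIV_listI)

definition word_of :: "nat \<Rightarrow> bool list"
  where "word_of = inv code_word"

lemma word_of_code_word [simp]: "word_of (code_word w) = w"
  by (simp add: word_of_def bij_code_word bij_is_inj)

lemma code_word_word_of [simp]: "code_word (word_of i) = i"
  by (simp add: word_of_def bij_code_word bij_is_surj surj_f_inv_f)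

lemma code_word_eq_iff [simp]: "code_word v = code_word w \<longleftrightarrow> v = w"
  by (metis word_of_code_word)

definition word_block :: "nat \<Rightarrow> nat"
  where "word_block i = code_word (block_key (word_of i))"

text \<open>
  The exponents tend to 2 so slowly that the factor \<open>k powr (1 / 2 - 1 / r)\<close>, with \<open>k\<close> the size of a
  block and \<open>r\<close> its exponent, still decays faster than any power of the word length.
\<close>

definition word_exponent :: "nat \<Rightarrow> real"
  where "word_exponent b = 2 / (1 + 1 / (2 * sqrt (length (word_of b) + 1)))"

lemma word_block_code_word [simp]: "word_block (code_word w) = code_word (block_key w)"
  by (simp add: word_block_def)

lemma word_block_vimage: "word_block -` {code_word k} = code_word ` {u. block_key u = k}"
proof (intro set_eqI iffI)
  fix i assume "i \<in> word_block -` {code_word k}"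
  then have "block_key (word_of i) = k" by (simp add: word_block_def)
  then show "i \<in> code_word ` {u. block_key u = k}" by (intro image_eqI[of _ _ "word_of i"]) auto
qed auto

lemma finite_block_key_fibre: "finite {u. block_key u = k}"
  by (rule finite_subset[OF _ finite_words[of "length k"]]) auto

lemma word_exponent_less_2: "word_exponent b < 2"
proof -
  define s where "s = sqrt (length (word_of b) + 1)"
  have "s > 0" by (simp add: s_def)
  then show ?thesis
    unfolding word_exponent_def s_def[symmetric] by (simp add: field_simps)
qed

lemma word_exponent_ge: "word_exponent b \<ge> 4 / 3"
proof -
  define s where "s = sqrt (length (word_of b) + 1)"
  have "s \<ge> 1" by (simp add: s_def)
  then show ?thesis
    unfolding word_exponent_def s_def[symmetric] by (simp add: field_simps)
qed

interpretation W: block_sum word_block word_exponent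
proof
  show "finite (word_block -` {b})" for b
    using word_block_vimage[of "word_of b"] finite_block_key_fibre[of "word_of b"] by simp
qed (use word_exponent_ge word_exponent_less_2 in \<open>auto intro: less_imp_le order_trans[of _ "4/3"]\<close>)

text \<open>The exponent depends only on the length of the word and tends to 2, so a bound below 2
  bounds the length.\<close>

lemma finite_word_exponent_less:
  assumes "p < 2"
  shows "finite {b. word_exponent b < p}"
proof (cases "p > 0")
  case False
  then have "{b. word_exponent b < p} = {}" using W.exponent_pos by (auto simp: not_less intro: less_imp_le order.strict_trans1)
  then show ?thesis by simp
next
  case True
  define d where "d = 2 / p - 1"
  have d: "d > 0" using assms True by (simp add: d_def)
  have "real (length (word_of b)) < (1 / (2 * d))\<^sup>2" if "word_exponent b < p" for b
  proof -
    define s where "s = sqrt (length (word_of b) + 1)"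
    have s: "s > 0" by (simp add: s_def)
    have "2 / (1 + 1 / (2 * s)) < p" using that by (simp add: word_exponent_def s_def)
    then have "2 / p < 1 + 1 / (2 * s)"
      using True s by (simp add: pos_divide_less_eq add_pos_nonneg mult.commute)
    then have "d < 1 / (2 * s)" by (simp add: d_def)
    then have "s < 1 / (2 * d)" using d s by (simp add: field_simps)
    then have "s\<^sup>2 < (1 / (2 * d))\<^sup>2" using s by (intro power_strict_mono) auto
    then show ?thesis by (simp add: s_def)
  qed
  then have "length (word_of b) < nat \<lceil>(1 / (2 * d))\<^sup>2\<rceil>" if "word_exponent b < p" for b
    using that by (metis less_ceiling_iff nat_less_iff zless_nat_conj of_int_of_nat_eq zless_nat_eq_int_zless)
  then have "{b. word_exponent b < p} \<subseteq> code_word ` (\<Union>n<nat \<lceil>(1 / (2 * d))\<^sup>2\<rceil>. {w. length w = n})"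
    by (auto intro!: image_eqI[of _ _ "word_of _"])
  moreover have "finite (code_word ` (\<Union>n<nat \<lceil>(1 / (2 * d))\<^sup>2\<rceil>. {w. length w = n}))"
    by (simp add: finite_words)
  ultimately show ?thesis by (rule finite_subset)
qed

section \<open>Szankowski's subspace\<close>

definition unit_word :: "bool list \<Rightarrow> nat \<Rightarrow> real"
  where "unit_word w = (\<lambda>i. of_bool (i = code_word w))"

lemma unit_word_apply [simp]: "unit_word w (code_word v) = of_bool (v = w)"
  by (simp add: unit_word_def)

definition relation_at :: "bool list \<Rightarrow> (nat \<Rightarrow> real) \<Rightarrow> real"
  where "relation_at w x = 2 * (x (code_word (False # w)) - x (code_word (True # w)))
    - (\<Sum>a\<in>UNIV. \<Sum>b\<in>UNIV. x (code_word (a # b # w)))"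

definition szankowski_space :: "(nat \<Rightarrow> real) set"
  where "szankowski_space = {x \<in> W.Y. \<forall>w. relation_at w x = 0}"

text \<open>Two functionals take the value 1 at this vector: half the difference of the entries at
  \<open>False # w\<close> and \<open>True # w\<close>, and a quarter of the sum of the entries at
  \<open>a # b # w\<close>. The relation at \<open>w\<close> says that they agree on the
  subspace.\<close>

definition z_vec :: "bool list \<Rightarrow> nat \<Rightarrow> real"
  where "z_vec w = unit_word (False # w) - unit_word (True # w)
    + (\<Sum>a\<in>UNIV. \<Sum>b\<in>UNIV. unit_word (a # b # w))"

lemma relation_at_add: "relation_at w (x + y) = relation_at w x + relation_at w y"
  by (simp add: relation_at_def UNIV_bool)

lemma relation_at_scale: "relation_at w (c *\<^sub>R x) = c * relation_at w x"
  by (simp add: relation_at_def UNIV_bool algebra_simps)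

lemma relation_at_diff: "relation_at w (x - y) = relation_at w x - relation_at w y"
  by (simp add: relation_at_def UNIV_bool)

text \<open>For \<open>v = w\<close> the two parts are 4 and 4. For \<open>v = b # w\<close> the
  difference cancels, and for \<open>w = b # v\<close> the four-term sum meets the entries 1 and -1
  only. In all other cases the supports are disjoint.\<close>

lemma relation_at_z_vec: "relation_at v (z_vec w) = 0"
proof -
  consider "v = w" | b where "v = b # w" | b where "w = b # v"
    | "v \<noteq> w" "\<And>b. v \<noteq> b # w" "\<And>b. w \<noteq> b # v" by blast
  then show ?thesis
  proof cases
    case 2
    then show ?thesis by (cases b) (simp_all add: relation_at_def z_vec_def UNIV_bool)
  next
    case 3
    then show ?thesis by (cases b) (simp_all add: relation_at_def z_vec_def UNIV_bool)
  qed (auto simp: relation_at_def z_vec_def UNIV_bool)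
qed

lemma subspace_szankowski_space: "subspace szankowski_space"
proof (rule subspaceI)
  show "0 \<in> szankowski_space"
    by (simp add: szankowski_space_def W.Y_zero relation_at_def)
qed (auto simp: szankowski_space_def relation_at_add relation_at_scale intro: W.Y_add W.Y_scale)

lemma szankowski_space_subset: "szankowski_space \<subseteq> W.Y"
  by (auto simp: szankowski_space_def)

lemma normed_szankowski_space: "normed_space szankowski_space W.N"
  by (rule W.normed_space_subset[OF subspace_szankowski_space szankowski_space_subset])

text \<open>The space is an intersection of kernels of functionals with common bound 8: two entries
  of weight 2 and four of weight 1.\<close>

lemma closedin_szankowski_space: "closedin (norm_topology W.Y W.N) szankowski_space"
  unfolding szankowski_space_def
proof (rule closedin_kernels[OF W.normed_space_Y])
  fix w x assume x: "x \<in> W.Y"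
  have "\<bar>relation_at w x\<bar> \<le> 2 * (\<bar>x (code_word (False # w))\<bar> + \<bar>x (code_word (True # w))\<bar>)
      + (\<Sum>a\<in>UNIV. \<Sum>b\<in>UNIV. \<bar>x (code_word (a # b # w))\<bar>)"
    by (simp add: relation_at_def UNIV_bool)
  also have "\<dots> \<le> 2 * (W.N x + W.N x) + (\<Sum>a\<in>(UNIV :: bool set). \<Sum>b\<in>(UNIV :: bool set). W.N x)"
    by (intro add_mono mult_left_mono sum_mono W.abs_le_N x) auto
  finally show "\<bar>relation_at w x\<bar> \<le> 8 * W.N x" by (simp add: UNIV_bool)
qed (auto simp: relation_at_diff)

lemma unit_word_in_Y: "unit_word w \<in> W.Y" and N_unit_word: "W.N (unit_word w) \<le> 1"
  using W.N_signed_units_le[of "{w}" code_word "\<lambda>_. 1"] by (simp_all add: unit_word_def)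

lemma z_vec_in_Y: "z_vec w \<in> W.Y"
  unfolding z_vec_def by (simp add: UNIV_bool) (intro W.Y_add W.Y_diff unit_word_in_Y)

lemma z_vec_in_space: "z_vec w \<in> szankowski_space"
  by (simp add: szankowski_space_def z_vec_in_Y relation_at_z_vec)

lemma N_diff: "W.N (x - y) \<le> W.N x + W.N y" if "x \<in> W.Y" "y \<in> W.Y"
  using W.N_add[OF that(1) W.Y_scale[OF that(2), of "- 1"]] W.N_uminus[OF that(2)] by simp

lemma N_z_vec: "W.N (z_vec w) \<le> 6"
proof -
  let ?u = unit_word
  have "W.N (z_vec w) \<le> W.N (?u (False # w)) + W.N (?u (True # w))
    + (W.N (?u (False # False # w)) + W.N (?u (False # True # w))
    + (W.N (?u (True # False # w)) + W.N (?u (True # True # w))))"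
    unfolding z_vec_def UNIV_bool
    by (simp) (intro order_trans[OF W.N_add] order_trans[OF N_diff] add_mono order_refl W.Y_add W.Y_diff unit_word_in_Y)
  then show ?thesis
    using N_unit_word[of "False # w"] N_unit_word[of "True # w"]
      N_unit_word[of "False # False # w"] N_unit_word[of "False # True # w"]
      N_unit_word[of "True # False # w"] N_unit_word[of "True # True # w"] by linarith
qed

definition bool_sign :: "bool \<Rightarrow> real"
  where "bool_sign a = (if a then - 1 else 1)"

text \<open>The entry at \<open>u = a # b # w\<close> of the image of this vector compares the two
  expressions for coefficients: the difference form for \<open>b # w\<close> and the sum form for
  \<open>w\<close>. The sign makes the entry of the first vector at \<open>u\<close> equal to 1, as
  it is for the second.\<close>

definition y_vec :: "bool list \<Rightarrow> nat \<Rightarrow> real"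
  where "y_vec u = bool_sign (hd u) *\<^sub>R z_vec (tl u) - z_vec (tl (tl u))"

lemma y_vec_in_space: "y_vec u \<in> szankowski_space"
  unfolding y_vec_def
  by (intro subspace_diff subspace_scale subspace_szankowski_space z_vec_in_space)

text \<open>
  The coordinate at the word \<open>a # b # w\<close> itself cancels. As \<open>a # b # w\<close> runs through one block, each
  of the remaining nine words runs through pairwise different blocks.
\<close>

lemma y_vec_expand:
  "y_vec (a # b # w) = (- 2) *\<^sub>R unit_word ((\<not> a) # b # w)
    + (bool_sign a *\<^sub>R unit_word (False # False # b # w) + bool_sign a *\<^sub>R unit_word (False # True # b # w)
    + (bool_sign a *\<^sub>R unit_word (True # False # b # w) + bool_sign a *\<^sub>R unit_word (True # True # b # w)))
    + (unit_word (True # w) - unit_word (False # w))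
    - (unit_word (False # (\<not> b) # w) + unit_word (True # (\<not> b) # w))" (is "_ = ?R")
proof -
  have "y_vec (a # b # w) i = ?R i" for i
    by (cases a; cases b) (simp_all add: y_vec_def z_vec_def UNIV_bool bool_sign_def)
  then show ?thesis by (rule ext)
qed

text \<open>Words in \<open>C\<close> agree outside one slot set, and equality of the new keys makes
  them agree outside another. The residues make these slot sets disjoint, so the words
  coincide.\<close>

lemma block_key_spread:
  fixes a b w0
  defines "C \<equiv> {w. clear_slots (slots a b (length w0)) w = clear_slots (slots a b (length w0)) w0}"
  shows "(a', b') \<noteq> (a, b) \<Longrightarrow> inj_on (\<lambda>w. block_key (a' # b' # w)) C"
    and "inj_on (\<lambda>w. block_key (c # d # b # w)) C"
    and "inj_on (\<lambda>w. block_key (c # w)) C"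
proof -
  let ?S = "slots a b (length w0)"
  have C: "length w = length w0" "clear_slots ?S w = clear_slots ?S w'" if "w \<in> C" "w' \<in> C" for w w'
    using that clear_slots_length_eq[of ?S w w0] by (auto simp: C_def)
  show "inj_on (\<lambda>w. block_key (a' # b' # w)) C" if ne: "(a', b') \<noteq> (a, b)"
  proof (rule inj_onI)
    fix w w' assume w: "w \<in> C" "w' \<in> C" and eq: "block_key (a' # b' # w) = block_key (a' # b' # w')"
    have "clear_slots (slots a' b' (length w0)) w = clear_slots (slots a' b' (length w0)) w'"
      using eq C(1)[OF w] C(1)[OF w(2,1)] by simp
    then show "w = w'"
      by (rule clear_slots_inject[OF C(2)[OF w]]) (use ne in \<open>auto intro!: slots_disjoint\<close>)
  qed
  show "inj_on (\<lambda>w. block_key (c # d # b # w)) C"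
  proof (rule inj_onI)
    fix w w' assume w: "w \<in> C" "w' \<in> C" and eq: "block_key (c # d # b # w) = block_key (c # d # b # w')"
    have "clear_slots (slots c d (Suc (length w0))) w = clear_slots (slots c d (Suc (length w0))) w'"
      using eq C(1)[OF w] C(1)[OF w(2,1)] by simp
    \<comment> \<open>The letter \<open>b\<close> in front of \<open>w\<close> belongs to the tail
      of the key, which raises the length by one and changes its residue mod 3.\<close>
    moreover have "length w0 mod 3 \<noteq> Suc (length w0) mod 3" by presburger
    then have "slots a b (length w0) \<inter> slots c d (Suc (length w0)) = {}" by (intro slots_disjoint) simp
    ultimately show "w = w'" by (rule clear_slots_inject[OF C(2)[OF w]])
  qed
  show "inj_on (\<lambda>w. block_key (c # w)) C"
  proof (rule inj_onI)
    fix w w' assume w: "w \<in> C" "w' \<in> C" and eq: "block_key (c # w) = block_key (c # w')"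
    \<comment> \<open>In \<open>c # w\<close> the first letter of \<open>w\<close> is the second
      letter of the key and is read off directly. The slot set for the rest belongs to a length one
      smaller.\<close>
    show "w = w'"
    proof (cases w)
      case Nil
      then show ?thesis using C(1)[OF w] C(1)[OF w(2,1)] by simp
    next
      case (Cons d v)
      then obtain d' v' where w': "w' = d' # v'"
        using C(1)[OF w] C(1)[OF w(2,1)] by (cases w') auto
      have len: "length v' = length v" "length w0 = Suc (length v)"
        using C(1)[OF w] C(1)[OF w(2,1)] by (auto simp: Cons w')
      have d: "d = d'" and c1: "clear_slots (slots c d (length v)) v = clear_slots (slots c d (length v)) v'"
        using eq len by (auto simp: Cons w')
      have c2: "clear_slots ?S v = clear_slots ?S v'"
        using C(2)[OF w] by (simp add: Cons w')
      have "length v mod 3 \<noteq> length w0 mod 3" unfolding len by presburger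
      then have "slots c d (length v) \<inter> ?S = {}" by (intro slots_disjoint) simp
      then have "v = v'" by (rule clear_slots_inject[OF c1 c2])
      then show ?thesis using d by (simp add: Cons w')
    qed
  qed
qed

text \<open>The expansion of \<open>y_vec\<close> splits the sum into nine families of unit vectors
  in pairwise different blocks. One family has coefficient of modulus 2 and eight have modulus 1,
  which gives 10.\<close>

lemma N_signed_y_vec:
  fixes a b w0
  defines "C \<equiv> {w. clear_slots (slots a b (length w0)) w = clear_slots (slots a b (length w0)) w0}"
  assumes \<theta>: "\<And>w. \<bar>\<theta> w\<bar> \<le> 1"
  shows "W.N (\<Sum>w\<in>C. \<theta> w *\<^sub>R y_vec (a # b # w)) \<le> 10 * sqrt (card C)"
proof -
  define G where "G = (\<lambda>\<psi>. \<Sum>w\<in>C. \<theta> w *\<^sub>R unit_word (\<psi> w))"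
  have fin: "finite C" unfolding C_def by (rule card_clear_slots_fibre)
  have G: "G \<psi> \<in> W.Y \<and> W.N (G \<psi>) \<le> sqrt (card C)" if "inj_on (\<lambda>w. block_key (\<psi> w)) C" for \<psi>
    unfolding G_def unit_word_def
    using W.N_signed_units_le[OF fin, of "\<lambda>w. code_word (\<psi> w)" \<theta>] that \<theta>
    by (simp add: inj_on_def)
  have cG: "c *\<^sub>R G \<psi> \<in> W.Y" "W.N (c *\<^sub>R G \<psi>) \<le> \<bar>c\<bar> * sqrt (card C)" if "inj_on (\<lambda>w. block_key (\<psi> w)) C" for \<psi> c
    using G[OF that] by (auto simp: W.N_scale intro!: W.Y_scale mult_left_mono)
  note spread = block_key_spread[where a = a and b = b and ?w0.0 = w0, folded C_def]
  define g1 where "g1 = (- 2) *\<^sub>R G (\<lambda>w. (\<not> a) # b # w)"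
  define g2 where "g2 = (\<lambda>c d. bool_sign a *\<^sub>R G (\<lambda>w. c # d # b # w))"
  define g3 where "g3 = (\<lambda>c. G (\<lambda>w. c # w))"
  define g4 where "g4 = (\<lambda>c. G (\<lambda>w. c # (\<not> b) # w))"
  have g1: "g1 \<in> W.Y" "W.N g1 \<le> 2 * sqrt (card C)"
    unfolding g1_def using cG[OF spread(1), of "\<not> a" b "- 2"] by auto
  have g2: "g2 c d \<in> W.Y" "W.N (g2 c d) \<le> sqrt (card C)" for c d
    unfolding g2_def using cG[OF spread(2), of "bool_sign a" c d] by (auto simp: bool_sign_def split: if_splits)
  have g3: "g3 c \<in> W.Y" "W.N (g3 c) \<le> sqrt (card C)" for c
    unfolding g3_def using G[OF spread(3), of c] by auto
  have g4: "g4 c \<in> W.Y" "W.N (g4 c) \<le> sqrt (card C)" for c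
    unfolding g4_def using G[OF spread(1), of c "\<not> b"] by auto
  have eq: "(\<Sum>w\<in>C. \<theta> w *\<^sub>R y_vec (a # b # w))
    = g1 + (g2 False False + g2 False True + (g2 True False + g2 True True)) + (g3 True - g3 False) - (g4 False + g4 True)"
    unfolding g1_def g2_def g3_def g4_def G_def y_vec_expand
    by (simp only: scaleR_add_right scaleR_diff_right sum.distrib sum_subtractf scaleR_sum_right scaleR_left_commute)
  show ?thesis
    unfolding eq
  proof -
    define s where "s = sqrt (card C)"
    have add: "x + y \<in> W.Y \<and> W.N (x + y) \<le> \<alpha> + \<beta>" and diff: "x - y \<in> W.Y \<and> W.N (x - y) \<le> \<alpha> + \<beta>"
      if "x \<in> W.Y \<and> W.N x \<le> \<alpha>" "y \<in> W.Y \<and> W.N y \<le> \<beta>" for x y \<alpha> \<beta>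
      using that W.N_add[of x y] N_diff[of x y] W.Y_add[of x y] W.Y_diff[of x y] by auto
    note g = conjI[OF g1, folded s_def] conjI[OF g2, folded s_def] conjI[OF g3, folded s_def] conjI[OF g4, folded s_def]
    have "W.N (g1 + (g2 False False + g2 False True + (g2 True False + g2 True True)) + (g3 True - g3 False) - (g4 False + g4 True))
      \<le> 2 * s + ((s + s) + (s + s)) + (s + s) + (s + s)"
      by (rule conjunct2, (rule add diff g)+)
    then show "W.N (g1 + (g2 False False + g2 False True + (g2 True False + g2 True True)) + (g3 True - g3 False) - (g4 False + g4 True))
      \<le> 10 * sqrt (card C)" by (simp add: s_def)
  qed
qed

lemma block_key_fibre:
  "{u. block_key u = block_key (a # b # w0)}
    = (\<lambda>w. a # b # w) ` {w. clear_slots (slots a b (length w0)) w = clear_slots (slots a b (length w0)) w0}"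
proof (intro set_eqI iffI)
  fix u assume u: "u \<in> {u. block_key u = block_key (a # b # w0)}"
  then have "length (block_key u) = length (block_key (a # b # w0))" by simp
  then have "length u = length w0 + 2" by simp
  then obtain c d w where "u = c # d # w" "length w = length w0"
    by (metis add_2_eq_Suc' length_Suc_conv)
  then show "u \<in> (\<lambda>w. a # b # w) ` {w. clear_slots (slots a b (length w0)) w = clear_slots (slots a b (length w0)) w0}"
    using u by auto
next
  fix u assume "u \<in> (\<lambda>w. a # b # w) ` {w. clear_slots (slots a b (length w0)) w = clear_slots (slots a b (length w0)) w0}"
  then obtain w where w: "u = a # b # w" "clear_slots (slots a b (length w0)) w = clear_slots (slots a b (length w0)) w0"
    by blast
  then have "length w = length w0" by (intro clear_slots_length_eq)
  then show "u \<in> {u. block_key u = block_key (a # b # w0)}" using w by simp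
qed

section \<open>The mean trace\<close>

text \<open>There are \<open>2 ^ n\<close> words, and the coefficient of \<open>z_vec w\<close> is
  half the difference shown; hence the exponent \<open>Suc n\<close>.\<close>

definition mean_trace :: "((nat \<Rightarrow> real) \<Rightarrow> nat \<Rightarrow> real) \<Rightarrow> nat \<Rightarrow> real"
  where "mean_trace R n = (\<Sum>w | length w = n.
    R (z_vec w) (code_word (False # w)) - R (z_vec w) (code_word (True # w))) / 2 ^ Suc n"

text \<open>For a block of size \<open>k\<close> and exponent \<open>r\<close> the scaling is by
  \<open>k powr (- 1 / r)\<close>, which is what \<open>k powr (1 - 1 / r)\<close> becomes after
  division by \<open>k\<close> in a mean over the block.\<close>

definition test_vec :: "bool list \<Rightarrow> (bool list \<Rightarrow> real) \<Rightarrow> nat \<Rightarrow> real"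
  where "test_vec u \<theta> =
    real (card {v. block_key v = block_key u}) powr (- 1 / word_exponent (code_word (block_key u)))
      *\<^sub>R (\<Sum>v | block_key v = block_key u. \<theta> v *\<^sub>R y_vec v)"

lemma test_vec_in_space: "test_vec u \<theta> \<in> szankowski_space"
  unfolding test_vec_def
  by (intro subspace_scale subspace_sum subspace_szankowski_space y_vec_in_space)

text \<open>An upper bound for \<open>k powr (1 / 2 - 1 / r)\<close> on words of length
  \<open>n + 2\<close>: the block size is at least \<open>2 ^ (n div 12)\<close>.\<close>

definition decay :: "nat \<Rightarrow> real"
  where "decay n = (2 ^ (n div 12)) powr (- 1 / (4 * sqrt (n + 3)))"

lemma N_test_vec_le:
  assumes u: "length u = n + 2" and \<theta>: "\<And>v. \<bar>\<theta> v\<bar> \<le> 1"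
  shows "W.N (test_vec u \<theta>) \<le> 10 * decay n"
proof -
  obtain a b w0 where ab: "u = a # b # w0" "length w0 = n"
    using u by (metis add_2_eq_Suc' length_Suc_conv)
  define C where "C = {w. clear_slots (slots a b (length w0)) w = clear_slots (slots a b (length w0)) w0}"
  define k where "k = real (card C)"
  define r where "r = word_exponent (code_word (block_key u))"
  have B: "{v. block_key v = block_key u} = (\<lambda>w. a # b # w) ` C"
    unfolding ab(1) C_def by (rule block_key_fibre)
  have inj: "inj_on (\<lambda>w. a # b # w) C" by (auto simp: inj_on_def)
  have card: "card {v. block_key v = block_key u} = card C"
    unfolding B by (rule card_image[OF inj])
  have "card C = 2 ^ card (slots a b (length w0) \<inter> {..<length w0})"
    unfolding C_def by (rule card_clear_slots_fibre)
  then have k: "k \<ge> 2 ^ (n div 12)"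
    using card_slots_ge[of n a b n] by (simp add: k_def ab)
  then have k0: "k > 0" by (smt (verit) zero_less_power)
  \<comment> \<open>The exponent uses the word length plus one, here \<open>n + 3\<close>. As the
    result is negative, a lower bound on \<open>k\<close> bounds the power from above.\<close>
  have r: "- 1 / r + 1 / 2 = - 1 / (4 * sqrt (n + 3))"
  proof -
    define s where "s = sqrt (n + 3)"
    have s: "s > 0" by (simp add: s_def)
    have r_eq: "r = 2 / (1 + 1 / (2 * s))"
      by (simp add: r_def word_exponent_def u s_def add.commute)
    show ?thesis unfolding s_def[symmetric] r_eq using s by (simp add: field_simps)
  qed
  have "test_vec u \<theta> = k powr (- 1 / r) *\<^sub>R (\<Sum>w\<in>C. \<theta> (a # b # w) *\<^sub>R y_vec (a # b # w))"
    unfolding test_vec_def card r_def k_def unfolding B sum.reindex[OF inj] by (simp add: o_def)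
  moreover have "(\<Sum>w\<in>C. \<theta> (a # b # w) *\<^sub>R y_vec (a # b # w)) \<in> W.Y"
    using y_vec_in_space szankowski_space_subset W.subspace_Y
    by (intro subspace_sum subspace_scale) auto
  ultimately have "W.N (test_vec u \<theta>) = k powr (- 1 / r) * W.N (\<Sum>w\<in>C. \<theta> (a # b # w) *\<^sub>R y_vec (a # b # w))"
    by (simp only: W.N_scale) simp
  also have "\<dots> \<le> k powr (- 1 / r) * (10 * sqrt (card C))"
    unfolding C_def by (intro mult_left_mono N_signed_y_vec \<theta>) auto
  also have "\<dots> = 10 * k powr (- 1 / r + 1 / 2)"
    using k0 by (simp only: powr_add powr_half_sqrt k_def)
  also have "\<dots> \<le> 10 * decay n"
    unfolding r decay_def using k by (intro mult_left_mono powr_mono2') auto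
  finally show ?thesis .
qed

section \<open>Linear operators on the subspace\<close>

text \<open>Linearity and invariance pass from an operator to its difference with the identity, and
  both are treated as instances.\<close>

locale szankowski_operator =
  fixes R :: "(nat \<Rightarrow> real) \<Rightarrow> nat \<Rightarrow> real"
  assumes maps: "x \<in> szankowski_space \<Longrightarrow> R x \<in> szankowski_space"
    and add: "x \<in> szankowski_space \<Longrightarrow> y \<in> szankowski_space \<Longrightarrow> R (x + y) = R x + R y"
    and scale: "x \<in> szankowski_space \<Longrightarrow> R (c *\<^sub>R x) = c *\<^sub>R R x"
begin

lemma R_in_Y: "x \<in> szankowski_space \<Longrightarrow> R x \<in> W.Y"
  using maps szankowski_space_subset by blast

lemma R_diff: "R (x - y) = R x - R y" if "x \<in> szankowski_space" "y \<in> szankowski_space"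
  using add[OF that(1) subspace_neg[OF subspace_szankowski_space that(2)]] scale[OF that(2), of "- 1"]
  by simp

lemma R_sum: "R (\<Sum>i\<in>A. c i *\<^sub>R f i) = (\<Sum>i\<in>A. c i *\<^sub>R R (f i))"
  if "\<And>i. i \<in> A \<Longrightarrow> f i \<in> szankowski_space"
  using that
proof (induction A rule: infinite_finite_induct)
  case (insert j A)
  have "c j *\<^sub>R f j \<in> szankowski_space" "(\<Sum>i\<in>A. c i *\<^sub>R f i) \<in> szankowski_space"
    using insert.prems by (auto intro!: subspace_scale subspace_sum subspace_szankowski_space)
  then have "R (c j *\<^sub>R f j + (\<Sum>i\<in>A. c i *\<^sub>R f i)) = c j *\<^sub>R R (f j) + (\<Sum>i\<in>A. c i *\<^sub>R R (f i))"
    using insert.prems insert.IH by (simp only: add scale insertI1 insertI2)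
  then show ?case by (simp only: sum.insert[OF insert.hyps])
qed (use scale[OF z_vec_in_space, of 0] in simp_all)

lemma R_y_vec: "R (y_vec (a # b # w)) = bool_sign a *\<^sub>R R (z_vec (b # w)) - R (z_vec w)"
proof -
  have "R (y_vec (a # b # w)) = R (bool_sign a *\<^sub>R z_vec (b # w)) - R (z_vec w)"
    unfolding y_vec_def list.sel
    by (intro R_diff subspace_scale subspace_szankowski_space z_vec_in_space)
  then show ?thesis by (simp only: scale[OF z_vec_in_space])
qed

text \<open>
  The relation at \<open>w\<close> rewrites the \<open>n\<close>-th mean as one over words of length \<open>n + 2\<close>, where it can be
  compared with the next one.
\<close>

lemma mean_trace_Suc_diff:
  "mean_trace R (Suc n) - mean_trace R n
    = (\<Sum>u | length u = n + 2. R (y_vec u) (code_word u)) / 2 ^ (n + 2)"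
proof -
  let ?c = code_word
  define D where "D = (\<lambda>w. R (z_vec w) (?c (False # w)) - R (z_vec w) (?c (True # w)))"
  define E where "E = (\<lambda>w. R (z_vec w) (?c (False # False # w)) + R (z_vec w) (?c (False # True # w))
    + R (z_vec w) (?c (True # False # w)) + R (z_vec w) (?c (True # True # w)))"
  \<comment> \<open>The image of \<open>z_vec w\<close> lies in the subspace again and thus
    satisfies the relation at \<open>w\<close>.\<close>
  have DE: "2 * D w = E w" for w
    using maps[OF z_vec_in_space, of w]
    by (auto simp: szankowski_space_def relation_at_def UNIV_bool D_def E_def dest!: spec[of _ w])
  have "(\<Sum>u | length u = n + 2. R (y_vec u) (?c u))
      = (\<Sum>w | length w = n. D (False # w) + D (True # w) - E w)"
    unfolding add_2_eq_Suc' sum_words_Suc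
    by (intro sum.cong refl) (simp add: R_y_vec bool_sign_def D_def E_def)
  also have "\<dots> = (\<Sum>w | length w = Suc n. D w) - 2 * (\<Sum>w | length w = n. D w)"
    by (simp only: sum_words_Suc sum_subtractf sum_distrib_left DE)
  finally have eq: "(\<Sum>u | length u = n + 2. R (y_vec u) (?c u))
    = (\<Sum>w | length w = Suc n. D w) - 2 * (\<Sum>w | length w = n. D w)" .
  have trace: "mean_trace R m = (\<Sum>w | length w = m. D w) / 2 ^ Suc m" for m
    by (simp add: mean_trace_def D_def)
  show ?thesis unfolding eq trace by (simp add: field_simps)
qed

text \<open>Suitable signs bound the diagonal sum by the l^1 norm, on the block, of the image of the
  signed sum. Passing to the l^r norm of the block costs \<open>k powr (1 - 1 / r)\<close>, and
  undoing the scaling of \<open>test_vec\<close> costs \<open>k powr (1 / r)\<close>; the product is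
  \<open>k\<close>.\<close>

lemma block_diagonal_le:
  fixes \<delta> :: real
  assumes \<delta>: "\<And>\<theta>. (\<And>v. \<theta> v \<in> {- 1, 1}) \<Longrightarrow> W.N (R (test_vec u \<theta>)) \<le> \<delta>"
  shows "\<bar>\<Sum>v | block_key v = block_key u. R (y_vec v) (code_word v)\<bar>
    \<le> card {v. block_key v = block_key u} * \<delta>"
proof -
  define B where "B = {v. block_key v = block_key u}"
  define k where "k = real (card B)"
  define r where "r = word_exponent (code_word (block_key u))"
  have fin: "finite B" unfolding B_def by (rule finite_block_key_fibre)
  have "u \<in> B" by (simp add: B_def)
  then have k: "k > 0" using fin by (auto simp: k_def card_gt_0_iff)
  have r: "r \<ge> 1" unfolding r_def by (rule W.exponent_ge)
  \<comment> \<open>The choice of signs gives only an upper bound; the factor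
    \<open>\<sigma>\<close> supplies the lower one.\<close>
  have one_sided: "\<sigma> * (\<Sum>v\<in>B. R (y_vec v) (code_word v)) \<le> k * \<delta>" if \<sigma>: "\<sigma> \<in> {- 1, 1}" for \<sigma>
  proof -
    obtain \<theta> where \<theta>: "\<And>v. \<theta> v \<in> {- 1, 1}"
      and le: "(\<Sum>v\<in>B. \<sigma> * R (y_vec v) (code_word v))
        \<le> (\<Sum>v\<in>B. \<Sum>w\<in>B. \<theta> v * \<theta> w * (\<sigma> * R (y_vec w) (code_word v)))"
      using exists_signs_diagonal_le[OF fin, of "\<lambda>v w. \<sigma> * R (y_vec w) (code_word v)"] by blast
    define g where "g = R (\<Sum>w\<in>B. \<theta> w *\<^sub>R y_vec w)"
    have g_eq: "g = (\<Sum>w\<in>B. \<theta> w *\<^sub>R R (y_vec w))"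
      unfolding g_def by (intro R_sum y_vec_in_space)
    have g_apply: "g i = (\<Sum>w\<in>B. \<theta> w * R (y_vec w) i)" for i
      unfolding g_eq using fin by (induction B) auto
    have sum_in: "(\<Sum>w\<in>B. \<theta> w *\<^sub>R y_vec w) \<in> szankowski_space"
      by (intro subspace_sum subspace_scale subspace_szankowski_space y_vec_in_space)
    have g_Y: "g \<in> W.Y" unfolding g_def by (intro R_in_Y sum_in)
    have "R (test_vec u \<theta>) = k powr (- 1 / r) *\<^sub>R g"
      unfolding test_vec_def g_def k_def r_def B_def using sum_in unfolding B_def by (rule scale)
    then have "k powr (- 1 / r) * W.N g \<le> \<delta>"
      using \<delta>[of \<theta>] \<theta> g_Y by (simp add: W.N_scale)
    then have "k powr (1 / r) * (k powr (- 1 / r) * W.N g) \<le> k powr (1 / r) * \<delta>"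
      by (rule mult_left_mono) simp
    moreover have "k powr (1 / r) * k powr (- 1 / r) = 1"
      using k by (simp flip: powr_add)
    ultimately have Ng: "W.N g \<le> k powr (1 / r) * \<delta>"
      by (simp only: mult.assoc [symmetric])
    have "\<sigma> * (\<Sum>v\<in>B. R (y_vec v) (code_word v)) \<le> (\<Sum>v\<in>B. \<sigma> * (\<theta> v * g (code_word v)))"
      using le by (simp add: g_apply sum_distrib_left mult_ac)
    also have "\<dots> \<le> (\<Sum>v\<in>B. \<bar>g (code_word v)\<bar>)"
    proof (rule sum_mono)
      fix v
      show "\<sigma> * (\<theta> v * g (code_word v)) \<le> \<bar>g (code_word v)\<bar>"
        using \<sigma> \<theta>[of v] by auto
    qed
    also have "\<dots> = (\<Sum>i\<in>code_word ` B. \<bar>g i\<bar>)"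
      by (subst sum.reindex) (auto simp: inj_on_def)
    also have "\<dots> \<le> card (code_word ` B) powr (1 - 1 / r) * lp_norm r (code_word ` B) g"
      using fin by (intro sum_abs_le_lp_norm r) auto
    also have "card (code_word ` B) = card B"
      by (intro card_image) (auto simp: inj_on_def)
    also have "lp_norm r (code_word ` B) g = W.bn g (code_word (block_key u))"
      by (simp only: block_norm_def word_block_vimage r_def B_def)
    also have "real (card B) powr (1 - 1 / r) * W.bn g (code_word (block_key u))
      \<le> k powr (1 - 1 / r) * (k powr (1 / r) * \<delta>)"
      unfolding k_def[symmetric]
      by (intro mult_left_mono order_trans[OF W.bn_le_N[OF g_Y] Ng]) auto
    also have "\<dots> = k * \<delta>" using k by (simp add: mult.assoc[symmetric] flip: powr_add)
    finally show ?thesis .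
  qed
  show ?thesis
    using one_sided[of 1] one_sided[of "- 1"] by (simp add: B_def k_def)
qed

text \<open>Keys preserve length, so the words of length \<open>n + 2\<close> split into whole
  blocks. The block sizes add up to \<open>2 ^ (n + 2)\<close>, which the denominator
  cancels.\<close>

lemma mean_trace_step_le:
  assumes \<delta>: "\<And>u \<theta>. length u = n + 2 \<Longrightarrow> (\<And>v. \<theta> v \<in> {- 1, 1}) \<Longrightarrow> W.N (R (test_vec u \<theta>)) \<le> \<delta>"
  shows "\<bar>mean_trace R (Suc n) - mean_trace R n\<bar> \<le> \<delta>"
proof -
  let ?W = "{u :: bool list. length u = n + 2}"
  let ?f = "\<lambda>u. R (y_vec u) (code_word u)"
  have fibre: "{u \<in> ?W. block_key u = block_key w} = {u. block_key u = block_key w}" if "w \<in> ?W" for w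
  proof -
    have "length u = n + 2" if "block_key u = block_key w" for u
      using arg_cong[OF that, of length] \<open>w \<in> ?W\<close> by simp
    then show ?thesis by blast
  qed
  have "\<bar>\<Sum>u\<in>?W. ?f u\<bar> = \<bar>\<Sum>k\<in>block_key ` ?W. \<Sum>u | u \<in> ?W \<and> block_key u = k. ?f u\<bar>"
    by (subst sum.image_gen[OF finite_words, of _ _ block_key]) simp
  also have "\<dots> \<le> (\<Sum>k\<in>block_key ` ?W. \<bar>\<Sum>u | u \<in> ?W \<and> block_key u = k. ?f u\<bar>)"
    by (rule sum_abs)
  also have "\<dots> \<le> (\<Sum>k\<in>block_key ` ?W. \<Sum>u | u \<in> ?W \<and> block_key u = k. \<delta>)"
  proof (rule sum_mono)
    fix k assume "k \<in> block_key ` ?W"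
    then obtain w where w: "w \<in> ?W" "k = block_key w" by blast
    show "\<bar>\<Sum>u | u \<in> ?W \<and> block_key u = k. ?f u\<bar> \<le> (\<Sum>u | u \<in> ?W \<and> block_key u = k. \<delta>)"
      using block_diagonal_le[of w \<delta>, OF \<delta>[of w]] w(1) unfolding w(2) fibre[OF w(1)] by simp
  qed
  also have "\<dots> = (\<Sum>u\<in>?W. \<delta>)"
    by (rule sum.image_gen[OF finite_words, symmetric])
  also have "\<dots> = 2 ^ (n + 2) * \<delta>" by (simp add: card_words del: power_Suc)
  finally show ?thesis
    unfolding mean_trace_Suc_diff by (simp add: field_simps)
qed

end

section \<open>The compact test set\<close>

text \<open>The exponent of 2 in \<open>decay\<close> behaves like a negative multiple of
  \<open>sqrt n\<close>, which beats every polynomial factor.\<close>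

lemma decay_tendsto_0: "(\<lambda>n. real ((n + 1) * (n + 2)) * (10 * decay n)) \<longlonglongrightarrow> 0"
proof -
  let ?f = "\<lambda>n::nat. (real n + 1) * (real n + 2) * (10 * 2 powr (- (real n / 12 - 1) / (4 * sqrt (real n + 3))))"
  have lim: "?f \<longlonglongrightarrow> 0" by real_asymp
  have "real ((n + 1) * (n + 2)) * (10 * decay n) \<le> ?f n" for n
  proof -
    have "real n \<le> real (12 * (n div 12) + 12)" by (subst of_nat_le_iff) presburger
    then have "real n / 12 - 1 \<le> real (n div 12)" by simp
    then have le: "real (n div 12) * (- 1 / (4 * sqrt (real n + 3))) \<le> (real n / 12 - 1) * (- 1 / (4 * sqrt (real n + 3)))"
      by (rule mult_right_mono_neg) simp
    have "decay n = 2 powr (real (n div 12) * (- 1 / (4 * sqrt (real n + 3))))"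
      unfolding decay_def powr_powr [symmetric] by (simp add: powr_realpow add.commute)
    also have "\<dots> \<le> 2 powr ((real n / 12 - 1) * (- 1 / (4 * sqrt (real n + 3))))"
      using le by (intro powr_mono) auto
    also have "(real n / 12 - 1) * (- 1 / (4 * sqrt (real n + 3))) = - (real n / 12 - 1) / (4 * sqrt (real n + 3))"
      by (simp only: times_divide_eq_right mult_minus1_right)
    finally have "decay n \<le> 2 powr (- (real n / 12 - 1) / (4 * sqrt (real n + 3)))" .
    then have "10 * decay n \<le> 10 * 2 powr (- (real n / 12 - 1) / (4 * sqrt (real n + 3)))" by simp
    then have "real ((n + 1) * (n + 2)) * (10 * decay n) \<le> real ((n + 1) * (n + 2)) * (10 * 2 powr (- (real n / 12 - 1) / (4 * sqrt (real n + 3))))"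
      by (rule mult_left_mono) simp
    moreover have "real ((n + 1) * (n + 2)) = (real n + 1) * (real n + 2)"
      by (simp only: of_nat_mult of_nat_add of_nat_1 of_nat_numeral)
    ultimately show ?thesis by (simp only: mult.assoc)
  qed
  then have upper: "\<forall>\<^sub>F n in sequentially. real ((n + 1) * (n + 2)) * (10 * decay n) \<le> ?f n" by simp
  have lower: "\<forall>\<^sub>F n in sequentially. 0 \<le> real ((n + 1) * (n + 2)) * (10 * decay n)"
    by (simp add: decay_def)
  show ?thesis by (rule tendsto_sandwich[OF lower upper tendsto_const lim])
qed

text \<open>Only finitely many signs matter, so each level of the test set can be finite.\<close>

lemma test_vec_cong:
  assumes "\<And>v. length v = length u \<Longrightarrow> \<theta> v = \<theta>' v"
  shows "test_vec u \<theta> = test_vec u \<theta>'"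
proof -
  have "\<theta> v = \<theta>' v" if "block_key v = block_key u" for v
    using assms arg_cong[OF that, of length] by simp
  then have "(\<Sum>v | block_key v = block_key u. \<theta> v *\<^sub>R y_vec v) = (\<Sum>v | block_key v = block_key u. \<theta>' v *\<^sub>R y_vec v)"
    by (intro sum.cong) auto
  then show ?thesis by (simp only: test_vec_def)
qed

text \<open>The reciprocals of the weights \<open>(n + 1) * (n + 2)\<close> telescope to total 1,
  while the weights themselves are absorbed by \<open>decay\<close>. Restricting the sign functions
  to words of one length keeps the set finite.\<close>

definition test_set_at :: "nat \<Rightarrow> (nat \<Rightarrow> real) set"
  where "test_set_at n = (\<lambda>(u, \<theta>). real ((n + 1) * (n + 2)) *\<^sub>R test_vec u \<theta>) `
    ({u. length u = n + 2} \<times> ({u. length u = n + 2} \<rightarrow>\<^sub>E {- 1, 1}))"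

text \<open>The vector \<open>z_vec []\<close> controls the mean trace at 0, the levels control its
  increments, and 0 is the limit point.\<close>

definition test_set :: "(nat \<Rightarrow> real) set"
  where "test_set = insert 0 (insert (z_vec []) (\<Union>n. test_set_at n))"

lemma finite_test_set_at: "finite (test_set_at n)"
  unfolding test_set_at_def by (intro finite_imageI finite_cartesian_product finite_PiE finite_words) auto

lemma test_vec_in_test_set:
  assumes "length u = n + 2" "\<And>v. \<theta> v \<in> {- 1, 1}"
  shows "real ((n + 1) * (n + 2)) *\<^sub>R test_vec u \<theta> \<in> test_set"
proof -
  define \<theta>' where "\<theta>' = restrict \<theta> {u. length u = n + 2}"
  have "test_vec u \<theta> = test_vec u \<theta>'"
    by (rule test_vec_cong) (simp add: \<theta>'_def assms(1))
  moreover have "\<theta>' \<in> {u. length u = n + 2} \<rightarrow>\<^sub>E {- 1, 1}"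
    unfolding \<theta>'_def using assms(2) by (simp only: restrict_PiE_iff) blast
  ultimately have "real ((n + 1) * (n + 2)) *\<^sub>R test_vec u \<theta> \<in> test_set_at n"
    unfolding test_set_at_def using assms(1) by (intro image_eqI[of _ _ "(u, \<theta>')"]) auto
  then show ?thesis by (auto simp: test_set_def)
qed

lemma test_set_at_bounds:
  assumes "x \<in> test_set_at n"
  shows "x \<in> szankowski_space" "W.N x \<le> real ((n + 1) * (n + 2)) * (10 * decay n)"
proof -
  obtain u \<theta> where u: "length u = n + 2" and \<theta>: "\<theta> \<in> {u. length u = n + 2} \<rightarrow>\<^sub>E {- 1, 1}"
    and x: "x = real ((n + 1) * (n + 2)) *\<^sub>R test_vec u \<theta>"
    using assms by (auto simp: test_set_at_def)
  \<comment> \<open>An extensional function is \<open>undefined\<close> elsewhere; the value 1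
    restores the bound on all words.\<close>
  define \<theta>' where "\<theta>' = (\<lambda>v. if length v = n + 2 then \<theta> v else 1)"
  have eq: "test_vec u \<theta> = test_vec u \<theta>'" by (rule test_vec_cong) (simp add: \<theta>'_def u)
  have "\<bar>\<theta>' v\<bar> \<le> 1" for v using PiE_mem[OF \<theta>, of v] by (auto simp: \<theta>'_def)
  then have "W.N (test_vec u \<theta>) \<le> 10 * decay n" unfolding eq by (rule N_test_vec_le[OF u])
  then have "real ((n + 1) * (n + 2)) * W.N (test_vec u \<theta>) \<le> real ((n + 1) * (n + 2)) * (10 * decay n)"
    by (rule mult_left_mono) simp
  moreover have "W.N x = real ((n + 1) * (n + 2)) * W.N (test_vec u \<theta>)"
    unfolding x using test_vec_in_space szankowski_space_subset by (subst W.N_scale) auto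
  ultimately show "W.N x \<le> real ((n + 1) * (n + 2)) * (10 * decay n)" by simp
  show "x \<in> szankowski_space"
    unfolding x by (intro subspace_scale subspace_szankowski_space test_vec_in_space)
qed

lemma compactin_test_set: "compactin (norm_topology szankowski_space W.N) test_set"
proof (rule compactin_null_set[OF normed_szankowski_space])
  show "test_set \<subseteq> szankowski_space"
    using test_set_at_bounds(1) z_vec_in_space subspace_0[OF subspace_szankowski_space]
    by (auto simp: test_set_def)
  show "0 \<in> test_set" by (simp add: test_set_def)
  fix e :: real assume e: "0 < e"
  obtain m where m: "\<And>n. n \<ge> m \<Longrightarrow> real ((n + 1) * (n + 2)) * (10 * decay n) < e"
    using order_tendstoD(2)[OF decay_tendsto_0 e] by (auto simp: eventually_sequentially)
  have "{x \<in> test_set. e \<le> W.N x} \<subseteq> insert 0 (insert (z_vec []) (\<Union>n<m. test_set_at n))"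
  proof
    fix x assume x: "x \<in> {x \<in> test_set. e \<le> W.N x}"
    have "n < m" if "x \<in> test_set_at n" for n
    proof (rule ccontr)
      assume "\<not> n < m"
      then show False using m[of n] test_set_at_bounds(2)[OF that] x by simp
    qed
    then show "x \<in> insert 0 (insert (z_vec []) (\<Union>n<m. test_set_at n))"
      using x by (auto simp: test_set_def)
  qed
  moreover have "finite (insert 0 (insert (z_vec []) (\<Union>n<m. test_set_at n)))"
    by (simp add: finite_test_set_at)
  ultimately show "finite {x \<in> test_set. e \<le> W.N x}" by (rule finite_subset)
qed

section \<open>Lower and upper bounds for the mean trace\<close>

text \<open>The identity has mean trace 1. For \<open>R = T - id\<close> the initial value
  contributes at most 1/4, and so do all increments together.\<close>

lemma mean_trace_near_identity:
  assumes T: "szankowski_operator T"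
    and close: "\<And>x. x \<in> test_set \<Longrightarrow> W.N (T x - x) < 1 / 4"
  shows "mean_trace T n \<ge> 1 / 2"
proof -
  interpret T: szankowski_operator T by (rule T)
  define R where "R = (\<lambda>x. T x - x)"
  interpret R: szankowski_operator R
  proof
    show "R x \<in> szankowski_space" if "x \<in> szankowski_space" for x
      unfolding R_def using that by (intro subspace_diff subspace_szankowski_space T.maps)
    show "R (x + y) = R x + R y" if "x \<in> szankowski_space" "y \<in> szankowski_space" for x y
      using that by (simp add: R_def T.add)
    show "R (c *\<^sub>R x) = c *\<^sub>R R x" if "x \<in> szankowski_space" for c x
      unfolding R_def T.scale[OF that] by (rule scaleR_diff_right [symmetric])
  qed
  have mean_trace_R: "mean_trace T n = mean_trace R n + 1" for n
  proof -
    have "(\<Sum>w | length w = n. T (z_vec w) (code_word (False # w)) - T (z_vec w) (code_word (True # w)))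
      = (\<Sum>w | length w = n. (R (z_vec w) (code_word (False # w)) - R (z_vec w) (code_word (True # w))) + 2)"
      by (intro sum.cong refl) (simp add: R_def z_vec_def UNIV_bool)
    also have "\<dots> = (\<Sum>w | length w = n. R (z_vec w) (code_word (False # w)) - R (z_vec w) (code_word (True # w))) + 2 * 2 ^ n"
      by (simp only: sum.distrib) (simp add: card_words)
    finally show ?thesis by (simp add: mean_trace_def add_divide_distrib)
  qed
  have step: "\<bar>mean_trace R (Suc n) - mean_trace R n\<bar> \<le> 1 / 4 / real ((n + 1) * (n + 2))" for n
  proof (rule R.mean_trace_step_le)
    fix u :: "bool list" and \<theta> :: "bool list \<Rightarrow> real"
    assume u: "length u = n + 2" and \<theta>: "\<And>v. \<theta> v \<in> {- 1, 1}"
    let ?c = "real ((n + 1) * (n + 2))"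
    have c: "?c > 0" by (simp only: of_nat_0_less_iff) simp
    have "W.N (R (?c *\<^sub>R test_vec u \<theta>)) < 1 / 4"
      unfolding R_def by (rule close[OF test_vec_in_test_set[OF u \<theta>]])
    moreover have "W.N (R (?c *\<^sub>R test_vec u \<theta>)) = ?c * W.N (R (test_vec u \<theta>))"
      unfolding R.scale[OF test_vec_in_space] by (subst W.N_scale[OF R.R_in_Y[OF test_vec_in_space]]) simp
    ultimately have "?c * W.N (R (test_vec u \<theta>)) \<le> 1 / 4" by simp
    then show "W.N (R (test_vec u \<theta>)) \<le> 1 / 4 / ?c"
      by (simp only: pos_le_divide_eq[OF c] mult.commute)
  qed
  \<comment> \<open>The bracket is 1 for the initial value plus the telescoping sum
    \<open>1 - 1 / (n + 1)\<close> of the increments.\<close>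
  have bound: "\<bar>mean_trace R n\<bar> \<le> 1 / 4 * (2 - 1 / (real n + 1))" for n
  proof (induction n)
    case 0
    have "W.N (R (z_vec [])) < 1 / 4" unfolding R_def by (rule close) (simp add: test_set_def)
    moreover have "\<bar>R (z_vec []) i\<bar> \<le> W.N (R (z_vec []))" for i
      by (rule W.abs_le_N[OF R.R_in_Y[OF z_vec_in_space]])
    ultimately have "\<bar>R (z_vec []) i\<bar> \<le> 1 / 4" for i by (meson less_imp_le order_trans)
    from this[of "code_word [False]"] this[of "code_word [True]"]
    have "\<bar>R (z_vec []) (code_word [False]) - R (z_vec []) (code_word [True])\<bar> \<le> 1 / 2" by linarith
    then show ?case by (simp add: mean_trace_def)
  next
    case (Suc n)
    have "1 / 4 / real ((n + 1) * (n + 2)) = 1 / 4 * (1 / (real n + 1) - 1 / (real (Suc n) + 1))"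
      by (simp add: field_simps)
    then show ?case using Suc step[of n] by (simp add: algebra_simps)
  qed
  have "\<bar>mean_trace R n\<bar> \<le> 1 / 4 * (2 - 0)"
    by (rule order_trans[OF bound], intro mult_left_mono diff_mono) auto
  then have "\<bar>mean_trace R n\<bar> \<le> 1 / 2" by simp
  then show ?thesis unfolding mean_trace_R by linarith
qed

text \<open>The images of all \<open>z_vec w\<close> are combinations of finitely many fixed vectors
  with uniformly bounded coefficients. The coordinates of these vectors become small at long words,
  and so do the diagonal terms.\<close>

lemma mean_trace_finite_rank:
  assumes T: "szankowski_operator T" and fin: "finite_rank_on szankowski_space T"
    and C: "\<And>x. x \<in> szankowski_space \<Longrightarrow> W.N (T x) \<le> C * W.N x"
  shows "\<exists>n. mean_trace T n < 1 / 2"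
proof -
  interpret T: szankowski_operator T by (rule T)
  obtain J u where J: "finite J" and u: "\<And>j. u j \<in> span (T ` szankowski_space)"
    and Tx: "\<And>x. x \<in> szankowski_space \<Longrightarrow> T x = (\<Sum>j\<in>J. T x j *\<^sub>R u j)"
    using finite_rank_coordinates[OF fin] by metis
  have uY: "u j \<in> W.Y" for j
    using u span_minimal[OF _ W.subspace_Y, of "T ` szankowski_space"] T.R_in_Y by blast
  define M where "M = \<bar>C\<bar> * 6"
  have M: "\<bar>T (z_vec w) j\<bar> \<le> M" for w j
  proof -
    have "\<bar>T (z_vec w) j\<bar> \<le> W.N (T (z_vec w))"
      by (rule W.abs_le_N[OF T.R_in_Y[OF z_vec_in_space]])
    also have "\<dots> \<le> C * W.N (z_vec w)" by (rule C[OF z_vec_in_space])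
    also have "\<dots> \<le> \<bar>C\<bar> * 6" by (intro mult_mono N_z_vec) auto
    finally show ?thesis by (simp add: M_def)
  qed
  \<comment> \<open>Chosen so that \<open>card J\<close> terms of size \<open>M * d\<close> add up
    to at most 1/4; the summands 1 keep the denominator positive.\<close>
  define d where "d = 1 / (4 * (card J + 1) * (M + 1))"
  have "M \<ge> 0" by (simp add: M_def)
  then have d: "d > 0" by (simp add: d_def)
  have "finite (\<Union>j\<in>J. length ` word_of ` {i. d \<le> \<bar>u j i\<bar>})"
    using J d uY by (intro finite_UN_I finite_imageI W.finite_large_coordinates) auto
  then obtain m where m: "\<And>l. l \<in> (\<Union>j\<in>J. length ` word_of ` {i. d \<le> \<bar>u j i\<bar>}) \<Longrightarrow> l \<le> m"
    by (meson finite_nat_set_iff_bounded_le)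
  have small: "\<bar>u j (code_word w)\<bar> \<le> d" if "j \<in> J" "length w > m" for j w
  proof (rule ccontr)
    assume "\<not> ?thesis"
    then have "length w \<in> (\<Union>j\<in>J. length ` word_of ` {i. d \<le> \<bar>u j i\<bar>})"
      using that(1) by (intro UN_I[of j] image_eqI[of _ _ "w"] image_eqI[of _ _ "code_word w"]) auto
    from m[OF this] that(2) show False by simp
  qed
  have T_small: "\<bar>T (z_vec w) (code_word v)\<bar> \<le> card J * (M * d)" if "length v > m" for v w
  proof -
    have "T (z_vec w) (code_word v) = (\<Sum>j\<in>J. T (z_vec w) j *\<^sub>R u j) (code_word v)"
      using Tx[OF z_vec_in_space, of w] by metis
    also have "\<dots> = (\<Sum>j\<in>J. T (z_vec w) j * u j (code_word v))"
      using J by (induction J) auto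
    finally have "\<bar>T (z_vec w) (code_word v)\<bar> \<le> (\<Sum>j\<in>J. \<bar>T (z_vec w) j\<bar> * \<bar>u j (code_word v)\<bar>)"
      by (simp add: order_trans[OF sum_abs] abs_mult)
    also have "\<dots> \<le> (\<Sum>j\<in>J. M * d)"
      using that \<open>M \<ge> 0\<close> by (intro sum_mono mult_mono M small) auto
    finally show ?thesis by simp
  qed
  have "card J * (M * d) \<le> 1 / 4"
  proof -
    define P where "P = (card J + 1) * (M + 1)"
    have "card J * M \<le> P" "P > 0"
      using \<open>M \<ge> 0\<close> unfolding P_def by (intro mult_mono mult_pos_pos; simp)+
    moreover have "d = 1 / (4 * P)" by (simp add: d_def P_def mult.assoc)
    ultimately show ?thesis by (simp add: divide_le_eq)
  qed
  \<comment> \<open>A word of length \<open>m\<close> suffices here because \<open>a # w\<close> is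
    one letter longer.\<close>
  then have T_small': "\<bar>T (z_vec w) (code_word (a # w))\<bar> \<le> 1 / 4" if "length w = m" for a w
    using T_small[of "a # w" w] that by simp
  have "(\<Sum>w | length w = m. T (z_vec w) (code_word (False # w)) - T (z_vec w) (code_word (True # w)))
     \<le> (\<Sum>w :: bool list | length w = m. 1 / 2)"
  proof (rule sum_mono)
    fix w :: "bool list" assume "w \<in> {w. length w = m}"
    then show "T (z_vec w) (code_word (False # w)) - T (z_vec w) (code_word (True # w)) \<le> 1 / 2"
      using T_small'[of w False] T_small'[of w True] by simp
  qed
  also have "\<dots> = 2 ^ m / 2" by (simp add: card_words)
  finally have "mean_trace T m \<le> 1 / 4"
    unfolding mean_trace_def by (simp add: field_simps)
  then show ?thesis by (intro exI[of _ m]) simp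
qed

lemma szankowski_space_not_approximation_property:
  "\<not> approximation_property szankowski_space W.N"
proof
  assume "approximation_property szankowski_space W.N"
  then obtain T where T: "bounded_operator_on szankowski_space W.N T"
    "finite_rank_on szankowski_space T" "\<And>x. x \<in> test_set \<Longrightarrow> W.N (T x - x) < 1 / 4"
    unfolding approximation_property_def using compactin_test_set by (meson zero_less_divide_1_iff zero_less_numeral)
  obtain C where C: "\<And>x. x \<in> szankowski_space \<Longrightarrow> W.N (T x) \<le> C * W.N x"
    using T(1) unfolding bounded_operator_on_def by blast
  have op: "szankowski_operator T"
    using T(1) by unfold_locales (auto simp: bounded_operator_on_def)
  obtain n where "mean_trace T n < 1 / 2"
    using mean_trace_finite_rank[OF op T(2) C] by blast
  moreover have "mean_trace T n \<ge> 1 / 2"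
    by (rule mean_trace_near_identity[OF op T(3)])
  ultimately show False by simp
qed

theorem mainTheorem2:
  shows "\<exists>(Y :: (nat \<Rightarrow> real) set) N.
    banach_space Y N \<and>
    type_index Y N = 2 \<and> cotype_index Y N = 2 \<and>
    (\<exists>Z. subspace Z \<and> Z \<subseteq> Y \<and> closedin (norm_topology Y N) Z \<and>
      \<not> approximation_property Z N)"
proof (intro exI conjI)
  show "banach_space W.Y W.N" by (rule W.banach_space_Y)
  show "type_index W.Y W.N = 2" by (rule W.type_index_eq_2) (rule finite_word_exponent_less)
  have "1 / 3 \<le> word_exponent b - 1" for b using word_exponent_ge[of b] by simp
  then show "cotype_index W.Y W.N = 2" by (intro W.cotype_index_eq_2[of "1 / 3"]) auto
qed (fact subspace_szankowski_space szankowski_space_subset closedin_szankowski_space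
  szankowski_space_not_approximation_property)+

end
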